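(* Let $\mathcal{H}$ be a Hilbert space, let $H\in B(\mathcal{H})_{\mathrm{sa}}$, let $M$ be a closed subspace of $\mathcal{H}$, and let $f$ be a strictly convex continuous function on an interval that includes $\sigma(H)$. If $f(\mathrm{pr}(H))=\mathrm{pr}(f(H))$, where $\mathrm{pr}$ denotes compression to $M$, then $M$ is invariant for $H$, i.e. $HM\subset M$.
   Context: $B(\mathcal{H})_{\mathrm{sa}}$ is the set of bounded self-adjoint operators on $\mathcal{H}$; $\sigma(\cdot)$ is the spectrum; functions of self-adjoint operators are defined by the continuous functional calculus. For $T\in B(\mathcal{H})$, the compression $\mathrm{pr}(T)\in B(M)$ is $\mathrm{pr}(T)=PT|_M$, where $P$ is the orthogonal projection of $\mathcal{H}$ onto $M$; $f(\mathrm{pr}(H))$ is computed in $B(M)$. *)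

theory Defs
  imports "HOL-Analysis.Analysis" "HOL-Computational_Algebra.Polynomial"
begin

section \<open>Complex Hilbert spaces\<close>

class complex_vector = real_vector +
  fixes scaleC :: "complex \<Rightarrow> 'a \<Rightarrow> 'a" (infixr "*\<^sub>C" 75)
  assumes scaleC_add_right: "a *\<^sub>C (x + y) = a *\<^sub>C x + a *\<^sub>C y"
    and scaleC_add_left: "(a + b) *\<^sub>C x = a *\<^sub>C x + b *\<^sub>C x"
    and scaleC_scaleC: "a *\<^sub>C (b *\<^sub>C x) = (a * b) *\<^sub>C x"
    and scaleC_one: "1 *\<^sub>C x = x"
    and scaleC_of_real: "complex_of_real r *\<^sub>C x = r *\<^sub>R x"

text \<open>The inner product is conjugate-linear in its first argument.\<close>

class complex_inner = complex_vector + real_normed_vector +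
  fixes cinner :: "'a \<Rightarrow> 'a \<Rightarrow> complex"
  assumes cinner_commute: "cinner x y = cnj (cinner y x)"
    and cinner_add_right: "cinner x (y + z) = cinner x y + cinner x z"
    and cinner_scaleC_right: "cinner x (c *\<^sub>C y) = c * cinner x y"
    and cinner_same: "cinner x x = complex_of_real ((norm x)\<^sup>2)"

class chilbert_space = complex_inner + complete_space

instantiation complex :: chilbert_space
begin

definition scaleC_complex_def: "c *\<^sub>C (z::complex) = c * z"

definition cinner_complex_def: "cinner (z::complex) w = cnj z * w"

instance
proof
  fix a b x y z :: complex and r :: real
  show "a *\<^sub>C (x + y) = a *\<^sub>C x + a *\<^sub>C y" "(a + b) *\<^sub>C x = a *\<^sub>C x + b *\<^sub>C x"
    "a *\<^sub>C (b *\<^sub>C x) = (a * b) *\<^sub>C x" "1 *\<^sub>C x = x"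
    by (simp_all add: scaleC_complex_def algebra_simps)
  show "complex_of_real r *\<^sub>C x = r *\<^sub>R x"
    by (simp add: scaleC_complex_def scaleR_conv_of_real)
  show "cinner x y = cnj (cinner y x)" "cinner x (y + z) = cinner x y + cinner x z"
    "cinner x (a *\<^sub>C y) = a * cinner x y"
    by (simp_all add: cinner_complex_def scaleC_complex_def algebra_simps)
  show "cinner x x = complex_of_real ((norm x)\<^sup>2)"
    by (simp only: cinner_complex_def complex_norm_square mult.commute)
qed

end

global_interpretation complex_vector: vector_space "scaleC :: complex \<Rightarrow> 'a \<Rightarrow> 'a::complex_vector"
  by unfold_locales (simp_all add: scaleC_add_right scaleC_add_left scaleC_scaleC scaleC_one)


section \<open>Operators on a closed subspace\<close>

text \<open>
  A closed complex subspace \<open>K\<close> of the ambient Hilbert space is itself a Hilbert space. An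
  operator on \<open>K\<close> is a function on the ambient type that is \<open>undefined\<close> outside \<open>K\<close>, so that
  equality of operators on \<open>K\<close> is equality in HOL. The ambient space is the case \<open>K = UNIV\<close>,
  where this convention is void.
\<close>

definition bounded_ops :: "'a::complex_inner set \<Rightarrow> ('a \<Rightarrow> 'a) set" where
  "bounded_ops K = {T \<in> K \<rightarrow>\<^sub>E K.
     (\<forall>x\<in>K. \<forall>y\<in>K. T (x + y) = T x + T y) \<and>
     (\<forall>c. \<forall>x\<in>K. T (c *\<^sub>C x) = c *\<^sub>C T x) \<and>
     (\<exists>C. \<forall>x\<in>K. norm (T x) \<le> C * norm x)}"

definition self_adjoint_ops :: "'a::complex_inner set \<Rightarrow> ('a \<Rightarrow> 'a) set" where
  "self_adjoint_ops K =
     {T \<in> bounded_ops K. \<forall>x\<in>K. \<forall>y\<in>K. cinner (T x) y = cinner x (T y)}"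

lemma bounded_ops_UNIV_iff:
  "T \<in> bounded_ops UNIV \<longleftrightarrow> bounded_linear T \<and> (\<forall>c x. T (c *\<^sub>C x) = c *\<^sub>C T x)"
proof
  assume T: "T \<in> bounded_ops UNIV"
  then obtain C where "\<forall>x. norm (T x) \<le> C * norm x"
    by (auto simp: bounded_ops_def)
  with T show "bounded_linear T \<and> (\<forall>c x. T (c *\<^sub>C x) = c *\<^sub>C T x)"
    by (auto simp: bounded_ops_def scaleC_of_real[symmetric] mult.commute
        intro!: bounded_linear_intro[where K = C])
next
  assume T: "bounded_linear T \<and> (\<forall>c x. T (c *\<^sub>C x) = c *\<^sub>C T x)"
  then have "\<exists>C. \<forall>x. norm (T x) \<le> C * norm x"
    using bounded_linear.bounded[of T] by (auto simp: mult.commute)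
  with T show "T \<in> bounded_ops UNIV"
    by (auto simp: bounded_ops_def linear_simps)
qed

text \<open>The \<open>z\<close> for which \<open>T - z\<close> has no two-sided inverse in the bounded operators on \<open>K\<close>.\<close>

definition op_spectrum :: "'a::complex_inner set \<Rightarrow> ('a \<Rightarrow> 'a) \<Rightarrow> complex set" where
  "op_spectrum K T = {z. \<not> (\<exists>S\<in>bounded_ops K. \<forall>x\<in>K.
     S (T x - z *\<^sub>C x) = x \<and> T (S x) - z *\<^sub>C S x = x)}"


section \<open>Continuous functional calculus\<close>

definition op_poly :: "'a::complex_inner set \<Rightarrow> real poly \<Rightarrow> ('a \<Rightarrow> 'a) \<Rightarrow> 'a \<Rightarrow> 'a" where
  "op_poly K p T = (\<lambda>x\<in>K. \<Sum>i\<le>degree p. coeff p i *\<^sub>R (T ^^ i) x)"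

text \<open>
  For self-adjoint \<open>T\<close> on \<open>K\<close> (whose spectrum is real) and real-valued \<open>f\<close> continuous on the
  spectrum of \<open>T\<close>, the operator \<open>f(T)\<close> is the limit in operator norm of \<open>p n (T)\<close>, where \<open>p n\<close>
  are polynomials converging to \<open>f\<close> uniformly on the spectrum. Convergence in the operator norm
  of \<open>K\<close> is expressed as uniform convergence on the closed unit ball of \<open>K\<close>.
\<close>

definition cfc :: "'a::complex_inner set \<Rightarrow> (real \<Rightarrow> real) \<Rightarrow> ('a \<Rightarrow> 'a) \<Rightarrow> 'a \<Rightarrow> 'a" where
  "cfc K f T = (THE S. S \<in> bounded_ops K \<and>
     (\<exists>p. uniform_limit {t. complex_of_real t \<in> op_spectrum K T} (\<lambda>n. poly (p n)) f sequentially \<and>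
          uniform_limit (K \<inter> cball 0 1) (\<lambda>n. op_poly K (p n) T) S sequentially))"


section \<open>Compressions and strict convexity\<close>

definition orth_proj :: "'a::complex_inner set \<Rightarrow> 'a \<Rightarrow> 'a" where
  "orth_proj M x = (THE y. y \<in> M \<and> (\<forall>z\<in>M. cinner z (x - y) = 0))"

definition compression :: "'a::complex_inner set \<Rightarrow> ('a \<Rightarrow> 'a) \<Rightarrow> 'a \<Rightarrow> 'a" where
  "compression M T = (\<lambda>x\<in>M. orth_proj M (T x))"

definition strictly_convex_on :: "real set \<Rightarrow> (real \<Rightarrow> real) \<Rightarrow> bool" where
  "strictly_convex_on I f \<longleftrightarrow> (\<forall>x\<in>I. \<forall>y\<in>I. \<forall>t. x \<noteq> y \<longrightarrow> 0 < t \<longrightarrow> t < 1 \<longrightarrow>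
     f ((1 - t) * x + t * y) < (1 - t) * f x + t * f y)"

end

theory Submission
  imports Defs "HOL-Computational_Algebra.Fundamental_Theorem_Algebra"
begin

text \<open>
  Write \<open>C\<close> for the compression of \<open>H\<close> to \<open>M\<close>, and let \<open>[lo, hi]\<close> be the convex hull of the
  spectrum of \<open>H\<close>. For an affine \<open>\<ell>\<close> the quadratic forms of \<open>(f - \<ell>)(H)\<close> and \<open>(f - \<ell>)(C)\<close>
  agree on \<open>M\<close>. If \<open>\<ell>\<close> is the chord of \<open>f\<close> over a short interval \<open>\<Delta>\<close>, then \<open>f - \<ell>\<close> is almost
  \<open>0\<close> on \<open>\<Delta>\<close>, while strict convexity bounds it below by a constant, independent of \<open>\<Delta>\<close>, at a
  fixed distance from \<open>\<Delta>\<close>. Hence vectors in the spectral subspace of \<open>C\<close> for \<open>\<Delta>\<close> almost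
  lie in the spectral subspace of \<open>H\<close> for a neighbourhood of \<open>\<Delta>\<close>. The squared error is of the
  order of a second difference of \<open>f\<close>; summed over a partition these telescope to a quantity that
  tends to \<open>0\<close> with the mesh, so \<open>w(H) \<phi>(C) = 0\<close> on \<open>M\<close> whenever \<open>w\<close> and \<open>\<phi>\<close> have separated
  supports. Decomposing \<open>x \<in> M\<close> by a partition of unity in \<open>C\<close> of mesh \<open>r\<close> then gives
  \<open>\<parallel>H x - C x\<parallel> \<le> 8 r \<parallel>x\<parallel>\<close>, so that \<open>H x = C x \<in> M\<close>.
\<close>

section \<open>Real inner product and orthogonal projection\<close>

lemma cinner_add_left: "cinner (x + y) z = cinner x z + cinner (y::'a::complex_inner) z"
  by (metis cinner_add_right cinner_commute complex_cnj_add)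

lemma cinner_scaleC_left: "cinner (c *\<^sub>C x) y = cnj c * cinner (x::'a::complex_inner) y"
  by (metis cinner_scaleC_right cinner_commute complex_cnj_mult)

lemma cinner_scaleR_right: "cinner x (r *\<^sub>R y) = of_real r * cinner (x::'a::complex_inner) y"
  by (metis scaleC_of_real cinner_scaleC_right)

lemma cinner_scaleR_left: "cinner (r *\<^sub>R x) y = of_real r * cinner (x::'a::complex_inner) y"
  by (metis scaleC_of_real cinner_scaleC_left complex_cnj_complex_of_real)

text \<open>The underlying real inner product: symmetric and real-bilinear, so quadratic expansions
  involve no conjugates. Complex identities are recovered by testing with
  \<open>\<i> *\<^sub>C y\<close> as well.\<close>

definition ri :: "'a::complex_inner \<Rightarrow> 'a \<Rightarrow> real" where
  "ri x y = Re (cinner x y)"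

lemma ri_commute: "ri x y = ri y x"
  unfolding ri_def by (metis cinner_commute complex_cnj cnj.simps(1))

lemma ri_add_right: "ri x (y + z) = ri x y + ri x z"
  by (simp add: ri_def cinner_add_right)

lemma ri_add_left: "ri (x + y) z = ri x z + ri y z"
  by (simp add: ri_def cinner_add_left)

lemma ri_scaleR_right: "ri x (r *\<^sub>R y) = r * ri x y"
  by (simp add: ri_def cinner_scaleR_right)

lemma ri_scaleR_left: "ri (r *\<^sub>R x) y = r * ri x y"
  by (simp add: ri_def cinner_scaleR_left)

lemma ri_minus_right: "ri x (- y) = - ri x y"
  using ri_scaleR_right[of x "-1" y] by simp

lemma ri_minus_left: "ri (- x) y = - ri x y"
  using ri_scaleR_left[of "-1" x y] by simp

lemma ri_diff_right: "ri x (y - z) = ri x y - ri x z"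
  using ri_add_right[of x y "-z"] by (simp add: ri_minus_right)

lemma ri_diff_left: "ri (x - y) z = ri x z - ri y z"
  using ri_add_left[of x "-y" z] by (simp add: ri_minus_left)

lemma ri_zero_right: "ri x 0 = 0"
  using ri_scaleR_right[of x 0 0] by simp

lemma ri_zero_left: "ri 0 x = 0"
  using ri_scaleR_left[of 0 0 x] by simp

lemma ri_sum_right: "ri x (\<Sum>i\<in>A. g i) = (\<Sum>i\<in>A. ri x (g i))"
  by (induction A rule: infinite_finite_induct) (simp_all add: ri_zero_right ri_add_right)

lemmas ri_simps = ri_add_right ri_add_left ri_scaleR_right ri_scaleR_left ri_minus_right
  ri_minus_left ri_diff_right ri_diff_left ri_zero_right ri_zero_left

lemma ri_same: "ri x x = (norm x)\<^sup>2"
  by (simp add: ri_def cinner_same)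

lemma norm_add_sq: "(norm (x + y))\<^sup>2 = (norm x)\<^sup>2 + 2 * ri x y + (norm y)\<^sup>2"
  using ri_commute[of x y] by (simp add: ri_same[symmetric] ri_simps)

lemma norm_diff_sq: "(norm (x - y))\<^sup>2 = (norm x)\<^sup>2 - 2 * ri x y + (norm y)\<^sup>2"
  using ri_commute[of x y] by (simp add: ri_same[symmetric] ri_simps)

lemma ri_le_norm: "ri x y \<le> norm x * norm y"
proof -
  have "(norm (x + y))\<^sup>2 \<le> (norm x + norm y)\<^sup>2"
    by (intro power_mono norm_triangle_ineq) auto
  then show ?thesis
    by (simp add: norm_add_sq power2_sum)
qed

lemma abs_ri_le_norm: "\<bar>ri x y\<bar> \<le> norm x * norm y"
  using ri_le_norm[of x y] ri_le_norm[of "-x" y] by (simp add: ri_simps abs_if)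

lemma parallelogram: "(norm (x + y))\<^sup>2 + (norm (x - y))\<^sup>2
    = 2 * (norm x)\<^sup>2 + 2 * (norm (y::'a::complex_inner))\<^sup>2"
  by (simp add: norm_add_sq norm_diff_sq)

lemma cinner_eq_ri: "cinner x y = Complex (ri x y) (- ri x (\<i> *\<^sub>C y))"
  by (simp add: complex_eq_iff ri_def cinner_scaleC_right)

lemma tendsto_ri:
  fixes g h :: "'c \<Rightarrow> 'b::complex_inner"
  assumes "(g \<longlongrightarrow> a) F" "(h \<longlongrightarrow> b) F"
  shows "((\<lambda>n. ri (g n) (h n)) \<longlongrightarrow> ri a b) F"
proof -
  \<comment> \<open>Polarization reduces continuity of the inner product to continuity of the
    norm.\<close>
  have eq: "ri x y = ((norm (x + y))\<^sup>2 - (norm (x - y))\<^sup>2) / 4" for x y :: 'b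
    by (simp add: norm_add_sq norm_diff_sq)
  show ?thesis unfolding eq by (intro tendsto_intros assms) auto
qed

text \<open>By axiom the norm is homogeneous for real scalars only; complex homogeneity is extracted
  from \<open>cinner_same\<close>, and it makes multiplication by \<open>c\<close> a bounded
  map.\<close>

lemma tendsto_scaleC:
  fixes g :: "'b \<Rightarrow> 'a::complex_inner"
  assumes "(g \<longlongrightarrow> a) F" shows "((\<lambda>n. c *\<^sub>C g n) \<longlongrightarrow> c *\<^sub>C a) F"
proof -
  have nrm: "norm (c *\<^sub>C x) = cmod c * norm x" for x :: 'a
  proof -
    have "complex_of_real ((norm (c *\<^sub>C x))\<^sup>2) = complex_of_real ((cmod c * norm x)\<^sup>2)"
      using complex_norm_square[of c]
      by (simp only: cinner_same[symmetric] cinner_scaleC_left cinner_scaleC_right power_mult_distrib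
          of_real_mult) (simp add: mult_ac)
    then have "(norm (c *\<^sub>C x))\<^sup>2 = (cmod c * norm x)\<^sup>2" by (simp only: of_real_eq_iff)
    then show ?thesis by simp
  qed
  have "bounded_linear (\<lambda>x::'a. c *\<^sub>C x)"
  proof (rule bounded_linear_intro[where K = "cmod c"])
    show "c *\<^sub>C (r *\<^sub>R x) = r *\<^sub>R (c *\<^sub>C x)" for r and x :: 'a
      by (simp add: scaleC_of_real[symmetric] scaleC_scaleC mult.commute)
  qed (simp_all add: scaleC_add_right nrm mult.commute)
  then show ?thesis using assms by (rule bounded_linear.tendsto)
qed

section \<open>Orthogonal projection onto a closed complex subspace\<close>

locale closed_csubspace =
  fixes K :: "'a::chilbert_space set"
  assumes subspaceC: "complex_vector.subspace K" and closed_K: "closed K"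
begin

lemma zero_mem: "0 \<in> K"
  by (rule complex_vector.subspace_0[OF subspaceC])

lemma add_mem: "x \<in> K \<Longrightarrow> y \<in> K \<Longrightarrow> x + y \<in> K"
  by (rule complex_vector.subspace_add[OF subspaceC])

lemma diff_mem: "x \<in> K \<Longrightarrow> y \<in> K \<Longrightarrow> x - y \<in> K"
  by (rule complex_vector.subspace_diff[OF subspaceC])

lemma scaleC_mem: "x \<in> K \<Longrightarrow> c *\<^sub>C x \<in> K"
  by (rule complex_vector.subspace_scale[OF subspaceC])

lemma scaleR_mem: "x \<in> K \<Longrightarrow> r *\<^sub>R x \<in> K"
  using scaleC_mem[of x "of_real r"] by (simp add: scaleC_of_real)

lemma sum_mem: "(\<And>i. i \<in> A \<Longrightarrow> g i \<in> K) \<Longrightarrow> (\<Sum>i\<in>A. g i) \<in> K"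
  by (rule complex_vector.subspace_sum[OF subspaceC])

lemma complete_K: "complete K"
  using closed_K by (simp add: complete_eq_closed)

text \<open>A minimizing sequence is Cauchy: midpoints of its terms stay in \<open>K\<close>, hence
  are no closer to \<open>x\<close> than the infimum, and the parallelogram law bounds the distance
  of two terms by their excess over it.\<close>

lemma nearest_point_exists:
  obtains y where "y \<in> K" "\<And>z. z \<in> K \<Longrightarrow> norm (x - y) \<le> norm (x - z)"
proof -
  define d where "d = Inf ((\<lambda>z. (norm (x - z))\<^sup>2) ` K)"
  have bdd: "bdd_below ((\<lambda>z. (norm (x - z))\<^sup>2) ` K)" by (rule bdd_belowI2[of _ 0]) simp
  have d_le: "d \<le> (norm (x - z))\<^sup>2" if "z \<in> K" for z
    unfolding d_def using that bdd by (rule cINF_lower[rotated])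
  have "\<exists>z\<in>K. (norm (x - z))\<^sup>2 < d + 1 / real (Suc n)" for n
    using cInf_lessD[of "(\<lambda>z. (norm (x - z))\<^sup>2) ` K" "d + 1 / real (Suc n)"] zero_mem
    unfolding d_def by (auto simp: d_def)
  then obtain s where s: "\<And>n. s n \<in> K" "\<And>n. (norm (x - s n))\<^sup>2 < d + 1 / real (Suc n)"
    by metis
  have close: "(norm (s m - s n))\<^sup>2 \<le> 2 / real (Suc m) + 2 / real (Suc n)" for m n
  proof -
    have "d \<le> (norm (x - (1/2) *\<^sub>R (s m + s n)))\<^sup>2"
      by (intro d_le scaleR_mem add_mem s)
    moreover have "(x - s m) + (x - s n) = 2 *\<^sub>R (x - (1/2) *\<^sub>R (s m + s n))"
      by (simp add: algebra_simps scaleR_2)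
    then have "(norm ((x - s m) + (x - s n)))\<^sup>2 = 4 * (norm (x - (1/2) *\<^sub>R (s m + s n)))\<^sup>2"
      by (simp add: power_mult_distrib)
    moreover have "(norm ((x - s m) - (x - s n)))\<^sup>2 = (norm (s m - s n))\<^sup>2"
      by (simp add: norm_minus_commute)
    ultimately show ?thesis
      using parallelogram[of "x - s m" "x - s n"] s(2)[of m] s(2)[of n] by simp
  qed
  have "Cauchy s"
  proof (rule metric_CauchyI)
    fix e :: real assume e: "0 < e"
    obtain N where N: "4 / e\<^sup>2 < real (Suc N)"
      using reals_Archimedean2[of "4 / e\<^sup>2"] by (meson less_trans of_nat_less_iff lessI)
    show "\<exists>N. \<forall>m\<ge>N. \<forall>n\<ge>N. dist (s m) (s n) < e"
    proof (intro exI allI impI)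
      fix m n assume mn: "N \<le> m" "N \<le> n"
      have "2 / real (Suc m) \<le> 2 / real (Suc N)" "2 / real (Suc n) \<le> 2 / real (Suc N)"
        using mn by (auto intro!: divide_left_mono)
      moreover have "4 / real (Suc N) < e\<^sup>2" using N e by (simp add: field_simps)
      ultimately have "(norm (s m - s n))\<^sup>2 < e\<^sup>2" using close[of m n] by simp
      then show "dist (s m) (s n) < e"
        using e by (simp add: dist_norm power_less_imp_less_base)
    qed
  qed
  then obtain y where y: "y \<in> K" "s \<longlonglongrightarrow> y"
    using complete_K s(1) unfolding complete_def by blast
  have "(norm (x - y))\<^sup>2 \<le> d"
  proof (rule LIMSEQ_le)
    show "(\<lambda>n. (norm (x - s n))\<^sup>2) \<longlonglongrightarrow> (norm (x - y))\<^sup>2"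
      by (intro tendsto_intros y)
    show "(\<lambda>n. d + 1 / real (Suc n)) \<longlonglongrightarrow> d"
      using tendsto_add[OF tendsto_const LIMSEQ_inverse_real_of_nat, of d]
      by (simp add: inverse_eq_divide)
    show "\<exists>N. \<forall>n\<ge>N. (norm (x - s n))\<^sup>2 \<le> d + 1 / real (Suc n)"
      using s(2) less_imp_le by blast
  qed
  then have "norm (x - y) \<le> norm (x - z)" if "z \<in> K" for z
    using order.trans[OF _ d_le[OF that]] power2_le_imp_le norm_ge_zero by blast
  with y(1) show ?thesis by (rule that)
qed

text \<open>The nearest point works, since moving it along \<open>z\<close> inside \<open>K\<close>
  cannot shorten the residual. Two candidates differ by a vector of \<open>K\<close> that is
  orthogonal to itself.\<close>

lemma orthogonal_decomposition:
  "\<exists>!y. y \<in> K \<and> (\<forall>z\<in>K. cinner z (x - y) = 0)"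
proof -
  obtain y where y: "y \<in> K" "\<And>z. z \<in> K \<Longrightarrow> norm (x - y) \<le> norm (x - z)"
    using nearest_point_exists by blast
  have re: "ri z (x - y) = 0" if z: "z \<in> K" for z
  proof (cases "z = 0")
    case False
    \<comment> \<open>The real coefficient of \<open>x - y\<close> along \<open>z\<close>; it
      minimizes the norm of \<open>(x - y) - c *\<^sub>R z\<close>.\<close>
    define c where "c = ri z (x - y) / (norm z)\<^sup>2"
    have "(norm (x - y))\<^sup>2 \<le> (norm (x - (y + c *\<^sub>R z)))\<^sup>2"
      using y z by (intro power_mono) (auto intro!: add_mem scaleR_mem)
    also have "x - (y + c *\<^sub>R z) = (x - y) - c *\<^sub>R z" by simp
    also have "(norm \<dots>)\<^sup>2 = (norm (x - y))\<^sup>2 - 2 * c * ri z (x - y) + c\<^sup>2 * (norm z)\<^sup>2"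
      by (subst norm_diff_sq) (simp add: ri_simps power_mult_distrib ri_commute[of _ z])
    also have "\<dots> = (norm (x - y))\<^sup>2 - (ri z (x - y))\<^sup>2 / (norm z)\<^sup>2"
      using False by (simp add: c_def field_simps power2_eq_square)
    finally have "(ri z (x - y))\<^sup>2 / (norm z)\<^sup>2 \<le> 0" by simp
    then show ?thesis using False by (simp add: divide_le_0_iff)
  qed (simp add: ri_simps)
  \<comment> \<open>Applying the real statement to \<open>\<i> *\<^sub>C z\<close> kills the
    imaginary part.\<close>
  have "cinner z (x - y) = 0" if z: "z \<in> K" for z
    using re[OF z] re[OF scaleC_mem[OF z, of \<i>]]
    by (simp add: ri_def cinner_scaleC_left complex_eq_iff)
  moreover have "y' = y" if "y' \<in> K" "\<forall>z\<in>K. cinner z (x - y') = 0" for y'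
  proof -
    have "y' - y \<in> K" using that y diff_mem by blast
    then have "ri (y' - y) (x - y) = 0" "ri (y' - y) (x - y') = 0"
      using re that by (auto simp: ri_def)
    then have "ri (y' - y) (y' - y) = 0" by (simp add: ri_simps)
    then show ?thesis by (simp add: ri_same)
  qed
  ultimately show ?thesis using y(1) by blast
qed

lemma orth_proj_mem: "orth_proj K x \<in> K"
  and cinner_orth_proj_diff: "z \<in> K \<Longrightarrow> cinner z (x - orth_proj K x) = 0"
  using theI'[OF orthogonal_decomposition[of x]] unfolding orth_proj_def by auto

lemma orth_proj_eqI:
  assumes "y \<in> K" "\<And>z. z \<in> K \<Longrightarrow> cinner z (x - y) = 0"
  shows "orth_proj K x = y"
  unfolding orth_proj_def using assms orthogonal_decomposition[of x] by (intro the1_equality) auto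

lemma cinner_orth_proj: "z \<in> K \<Longrightarrow> cinner z (orth_proj K x) = cinner z x"
  using cinner_orth_proj_diff[of z x] cinner_add_right[of z "x - orth_proj K x" "orth_proj K x"]
  by simp

lemma ri_orth_proj: "z \<in> K \<Longrightarrow> ri z (orth_proj K x) = ri z x"
  by (simp add: ri_def cinner_orth_proj)

lemma norm_orth_proj_le: "norm (orth_proj K x) \<le> norm x"
proof -
  have "(norm (orth_proj K x))\<^sup>2 \<le> norm (orth_proj K x) * norm x"
    using ri_le_norm[of "orth_proj K x" x] ri_orth_proj[OF orth_proj_mem, of x x]
    by (simp add: ri_same)
  then show ?thesis
    by (cases "orth_proj K x = 0") (simp_all add: power2_eq_square)
qed

lemma orth_proj_add: "orth_proj K (x + y) = orth_proj K x + orth_proj K y"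
proof (rule orth_proj_eqI)
  fix z assume "z \<in> K"
  moreover have "x + y - (orth_proj K x + orth_proj K y)
      = (x - orth_proj K x) + (y - orth_proj K y)" by simp
  ultimately show "cinner z (x + y - (orth_proj K x + orth_proj K y)) = 0"
    by (simp only: cinner_add_right cinner_orth_proj_diff) simp
qed (intro add_mem orth_proj_mem)

lemma orth_proj_scaleC: "orth_proj K (c *\<^sub>C x) = c *\<^sub>C orth_proj K x"
proof (rule orth_proj_eqI)
  fix z assume "z \<in> K"
  moreover have "c *\<^sub>C x - c *\<^sub>C orth_proj K x = c *\<^sub>C (x - orth_proj K x)"
    by (simp add: complex_vector.scale_right_diff_distrib)
  ultimately show "cinner z (c *\<^sub>C x - c *\<^sub>C orth_proj K x) = 0"
    by (simp only: cinner_scaleC_right cinner_orth_proj_diff) simp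
qed (intro scaleC_mem orth_proj_mem)

lemma compression_self_adjoint:
  assumes H: "H \<in> self_adjoint_ops UNIV"
  shows "compression K H \<in> self_adjoint_ops K"
proof -
  obtain B where B: "\<And>x. norm (H x) \<le> B * norm x"
    using H by (auto simp: self_adjoint_ops_def bounded_ops_def)
  have H1: "H (x + y) = H x + H y" "H (c *\<^sub>C x) = c *\<^sub>C H x" "cinner (H x) y = cinner x (H y)" for x y c
    using H by (simp_all add: self_adjoint_ops_def bounded_ops_def)
  have "norm (orth_proj K (H x)) \<le> B * norm x" for x
    using norm_orth_proj_le[of "H x"] B[of x] by (rule order.trans)
  moreover have "cinner (orth_proj K (H x)) y = cinner x (orth_proj K (H y))"
    if "x \<in> K" "y \<in> K" for x y
    using cinner_commute[of "orth_proj K (H x)" y] cinner_commute[of "H x" y] H1(3)[of x y]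
    by (simp add: that cinner_orth_proj)
  ultimately show ?thesis
    unfolding self_adjoint_ops_def bounded_ops_def compression_def
    by (simp add: orth_proj_mem H1(1,2) orth_proj_add orth_proj_scaleC add_mem scaleC_mem) blast
qed

end

section \<open>Polynomials in a self-adjoint operator\<close>

context closed_csubspace
begin

context
  fixes A assumes A: "A \<in> bounded_ops K"
begin

lemma bounded_ops_mem: "x \<in> K \<Longrightarrow> A x \<in> K"
  using A by (auto simp: bounded_ops_def)

lemma bounded_ops_add: "x \<in> K \<Longrightarrow> y \<in> K \<Longrightarrow> A (x + y) = A x + A y"
  using A by (auto simp: bounded_ops_def)

lemma bounded_ops_scaleC: "x \<in> K \<Longrightarrow> A (c *\<^sub>C x) = c *\<^sub>C A x"
  using A by (auto simp: bounded_ops_def)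

lemma bounded_ops_scaleR: "x \<in> K \<Longrightarrow> A (r *\<^sub>R x) = r *\<^sub>R A x"
  using bounded_ops_scaleC[of x "of_real r"] by (simp add: scaleC_of_real)

lemma bounded_ops_zero: "A 0 = 0"
  using bounded_ops_scaleR[of 0 0] zero_mem by simp

lemma bounded_ops_diff: "x \<in> K \<Longrightarrow> y \<in> K \<Longrightarrow> A (x - y) = A x - A y"
  using bounded_ops_add[of x "(-1) *\<^sub>R y"] bounded_ops_scaleR[of y "-1"] scaleR_mem[of y "-1"]
  by simp

lemma bounded_ops_sum: "(\<And>i. i \<in> S \<Longrightarrow> g i \<in> K) \<Longrightarrow> A (\<Sum>i\<in>S. g i) = (\<Sum>i\<in>S. A (g i))"
  by (induction S rule: infinite_finite_induct) (auto simp: bounded_ops_zero bounded_ops_add sum_mem)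

lemma bounded_ops_undefined: "x \<notin> K \<Longrightarrow> A x = undefined"
  using A by (auto simp: bounded_ops_def PiE_def extensional_def)

lemma bounded_ops_bound:
  obtains B where "B > 0" "\<And>x. x \<in> K \<Longrightarrow> norm (A x) \<le> B * norm x"
proof -
  obtain B where B: "\<And>x. x \<in> K \<Longrightarrow> norm (A x) \<le> B * norm x"
    using A unfolding bounded_ops_def by blast
  have "norm (A x) \<le> max 1 B * norm x" if "x \<in> K" for x
    using B[OF that] by (rule order.trans) (simp add: mult_right_mono)
  then show ?thesis by (intro that[of "max 1 B"]) simp_all
qed

end

section \<open>Quadratic forms and lower bounds of self-adjoint operators\<close>

lemma bounded_ops_eqI:
  assumes "A \<in> bounded_ops K" "B \<in> bounded_ops K" "\<And>x. x \<in> K \<Longrightarrow> A x = B x"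
  shows "A = B"
  using assms bounded_ops_undefined by (metis ext)

lemma self_adjoint_imp_bounded_ops: "A \<in> self_adjoint_ops K \<Longrightarrow> A \<in> bounded_ops K"
  by (simp add: self_adjoint_ops_def)

lemma self_adjoint_cinner:
  "A \<in> self_adjoint_ops K \<Longrightarrow> x \<in> K \<Longrightarrow> y \<in> K \<Longrightarrow> cinner (A x) y = cinner x (A y)"
  by (simp add: self_adjoint_ops_def)

lemma self_adjoint_ri:
  "A \<in> self_adjoint_ops K \<Longrightarrow> x \<in> K \<Longrightarrow> y \<in> K \<Longrightarrow> ri (A x) y = ri x (A y)"
  by (simp add: ri_def self_adjoint_cinner)

lemma self_adjoint_opsI:
  assumes "\<And>x. x \<in> K \<Longrightarrow> A x \<in> K" "\<And>x. x \<notin> K \<Longrightarrow> A x = undefined"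
    and "\<And>x y. x \<in> K \<Longrightarrow> y \<in> K \<Longrightarrow> A (x + y) = A x + A y"
    and "\<And>c x. x \<in> K \<Longrightarrow> A (c *\<^sub>C x) = c *\<^sub>C A x"
    and "\<And>x. x \<in> K \<Longrightarrow> norm (A x) \<le> B * norm x"
    and "\<And>x y. x \<in> K \<Longrightarrow> y \<in> K \<Longrightarrow> cinner (A x) y = cinner x (A y)"
  shows "A \<in> self_adjoint_ops K"
proof -
  have "\<exists>C. \<forall>x\<in>K. norm (A x) \<le> C * norm x" using assms(5) by blast
  then show ?thesis
    using assms(1-4,6) by (simp add: self_adjoint_ops_def bounded_ops_def PiE_def extensional_def)
qed

text \<open>The form is nonnegative at \<open>x - t *\<^sub>R A x\<close> for every
  \<open>t\<close>, and the best \<open>t\<close> gives the bound. It turns a small value of the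
  form into a small vector \<open>A x\<close>.\<close>

lemma positive_form_inner:
  assumes "\<And>x. x \<in> K \<Longrightarrow> 0 \<le> ri x (A x)" and A: "A \<in> self_adjoint_ops K"
    and B: "\<And>x. x \<in> K \<Longrightarrow> norm (A x) \<le> B * norm x" and x: "x \<in> K"
  shows "(norm (A x))\<^sup>2 \<le> B * ri x (A x)"
proof -
  note Ab = self_adjoint_imp_bounded_ops[OF A]
  have Ax: "A x \<in> K" by (rule bounded_ops_mem[OF Ab x])
  define q where "q = ri x (A x)"
  define s where "s = (norm (A x))\<^sup>2"
  \<comment> \<open>The sign of \<open>B\<close> is not given, but a negative bound forces
    \<open>A x = 0\<close>.\<close>
  have B0: "0 \<le> B \<or> A x = 0"
    using order.trans[OF B[OF x] mult_nonpos_nonneg[of B "norm x"]] by (cases "0 \<le> B") simp_all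
  have quad: "0 \<le> q - 2 * t * s + t\<^sup>2 * (B * s)" for t
  proof -
    have "x - t *\<^sub>R A x \<in> K" by (intro diff_mem scaleR_mem x Ax)
    then have "0 \<le> ri (x - t *\<^sub>R A x) (A (x - t *\<^sub>R A x))" by (rule assms(1))
    also have "A (x - t *\<^sub>R A x) = A x - t *\<^sub>R A (A x)"
      using x Ax by (simp add: bounded_ops_diff[OF Ab] bounded_ops_scaleR[OF Ab] scaleR_mem)
    also have "ri (x - t *\<^sub>R A x) (A x - t *\<^sub>R A (A x)) = q - 2 * t * s + t\<^sup>2 * ri (A x) (A (A x))"
      using self_adjoint_ri[OF A x Ax, symmetric]
      by (simp add: ri_simps q_def s_def ri_same[symmetric]) (simp add: power2_eq_square algebra_simps)
    also have "ri (A x) (A (A x)) \<le> B * s"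
      using ri_le_norm[of "A x" "A (A x)"] mult_left_mono[OF B[OF Ax], of "norm (A x)"]
      by (simp add: s_def power2_eq_square mult_ac)
    finally show ?thesis by (simp add: mult_left_mono)
  qed
  show ?thesis
  proof (cases "s = 0")
    case True
    then show ?thesis using assms(1)[OF x] B0 by (auto simp: s_def ri_zero_right)
  next
    case False
    then have s: "0 < s" "A x \<noteq> 0" by (auto simp: s_def)
    then have "0 < B" using B[OF x] B0 by (cases "B = 0") auto
    \<comment> \<open>At \<open>t = 1 / B\<close> the quadratic inequality reads
      \<open>0 \<le> q - s / B\<close>.\<close>
    then show ?thesis using quad[of "1 / B"] s by (simp add: field_simps power2_eq_square q_def s_def)
  qed
qed

text \<open>A substitute for invertibility: it holds for \<open>T - a\<close> whenever
  \<open>a\<close> is outside the spectrum, and it passes to products.\<close>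

definition bdd_below_op :: "('a \<Rightarrow> 'a) \<Rightarrow> bool" where
  "bdd_below_op A \<longleftrightarrow> (\<exists>c>0. \<forall>x\<in>K. c * norm x \<le> norm (A x))"

lemma bdd_below_op_comp:
  assumes "bdd_below_op A" "bdd_below_op B" "\<And>x. x \<in> K \<Longrightarrow> B x \<in> K"
  shows "bdd_below_op (\<lambda>x. A (B x))"
proof -
  obtain c d where cd: "c > 0" "\<And>x. x \<in> K \<Longrightarrow> c * norm x \<le> norm (A x)"
    "d > 0" "\<And>x. x \<in> K \<Longrightarrow> d * norm x \<le> norm (B x)"
    using assms(1,2) by (auto simp: bdd_below_op_def)
  have "(c * d) * norm x \<le> norm (A (B x))" if "x \<in> K" for x
  proof -
    have "c * (d * norm x) \<le> c * norm (B x)" using cd(1,4) that by (intro mult_left_mono) auto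
    also have "\<dots> \<le> norm (A (B x))" by (rule cd(2)[OF assms(3)[OF that]])
    finally show ?thesis by (simp add: mult.assoc)
  qed
  then show ?thesis using cd by (auto simp: bdd_below_op_def intro!: exI[of _ "c * d"])
qed

lemma bdd_below_op_cong: "(\<And>x. x \<in> K \<Longrightarrow> A x = B x) \<Longrightarrow> bdd_below_op A = bdd_below_op B"
  by (auto simp: bdd_below_op_def)

text \<open>The lower end of the numerical range. On \<open>K = {0}\<close> it is an infimum over
  the empty set, hence the hypothesis \<open>K \<noteq> {0}\<close> in results that use its
  value.\<close>

definition num_inf :: "('a \<Rightarrow> 'a) \<Rightarrow> real" where
  "num_inf A = Inf ((\<lambda>x. ri x (A x)) ` {x \<in> K. norm x = 1})"

lemma num_inf_le:
  assumes A: "A \<in> self_adjoint_ops K" and x: "x \<in> K"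
  shows "num_inf A * (norm x)\<^sup>2 \<le> ri x (A x)"
proof (cases "x = 0")
  case False
  note Ab = self_adjoint_imp_bounded_ops[OF A]
  obtain B where B: "\<And>x. x \<in> K \<Longrightarrow> norm (A x) \<le> B * norm x"
    using bounded_ops_bound[OF Ab] by blast
  have "bdd_below ((\<lambda>x. ri x (A x)) ` {x \<in> K. norm x = 1})"
  proof (rule bdd_belowI2)
    fix y assume "y \<in> {x \<in> K. norm x = 1}"
    then show "- B \<le> ri y (A y)" using abs_ri_le_norm[of y "A y"] B[of y] by simp
  qed
  then have "num_inf A \<le> ri ((1 / norm x) *\<^sub>R x) (A ((1 / norm x) *\<^sub>R x))"
    unfolding num_inf_def by (rule cINF_lower) (simp add: False scaleR_mem x)
  also have "\<dots> = ri x (A x) / (norm x)\<^sup>2"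
    using x by (simp add: bounded_ops_scaleR[OF Ab] ri_simps power2_eq_square)
  finally show ?thesis using False by (simp add: field_simps)
qed (simp add: ri_simps)

text \<open>A lower bound \<open>c\<close> for \<open>D = A - num_inf A\<close> would, by
  \<open>positive_form_inner\<close>, keep the form of \<open>D\<close> at least \<open>e\<close>
  above \<open>0\<close> on unit vectors, contradicting that \<open>num_inf A\<close> is the
  infimum.\<close>

lemma num_inf_not_bdd_below:
  assumes A: "A \<in> self_adjoint_ops K" and nz: "K \<noteq> {0}"
  shows "\<not> bdd_below_op (\<lambda>x. A x - num_inf A *\<^sub>R x)"
proof
  note Ab = self_adjoint_imp_bounded_ops[OF A]
  let ?m = "num_inf A"
  define D where "D = (\<lambda>x\<in>K. A x - ?m *\<^sub>R x)"
  obtain B where B: "B > 0" "\<And>x. x \<in> K \<Longrightarrow> norm (A x) \<le> B * norm x"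
    using bounded_ops_bound[OF Ab] by blast
  have DB: "norm (D x) \<le> (B + \<bar>?m\<bar>) * norm x" if "x \<in> K" for x
    using norm_triangle_ineq4[of "A x" "?m *\<^sub>R x"] B(2)[OF that] that
    by (simp add: D_def algebra_simps)
  have D: "D \<in> self_adjoint_ops K"
  proof (rule self_adjoint_opsI[where B = "B + \<bar>?m\<bar>"])
    show "cinner (D x) y = cinner x (D y)" if "x \<in> K" "y \<in> K" for x y
      using self_adjoint_cinner[OF A that] that
        cinner_add_left[of "A x" "(- ?m) *\<^sub>R x" y] cinner_add_right[of x "A y" "(- ?m) *\<^sub>R y"]
        cinner_scaleR_left[of "- ?m" x y] cinner_scaleR_right[of x "- ?m" y]
      by (simp add: D_def)
    show "D (c *\<^sub>C x) = c *\<^sub>C D x" if "x \<in> K" for c x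
      using that by (simp add: D_def scaleC_mem bounded_ops_scaleC[OF Ab]
          complex_vector.scale_right_diff_distrib scaleC_of_real[symmetric] scaleC_scaleC mult.commute)
  qed (simp_all add: DB, simp_all add: D_def diff_mem bounded_ops_mem[OF Ab] scaleR_mem add_mem
      bounded_ops_add[OF Ab] algebra_simps)
  have pos: "0 \<le> ri x (D x)" if "x \<in> K" for x
    using num_inf_le[OF A that] that by (simp add: D_def ri_simps ri_same)
  assume "bdd_below_op (\<lambda>x. A x - ?m *\<^sub>R x)"
  then obtain c where c: "c > 0" "\<And>x. x \<in> K \<Longrightarrow> c * norm x \<le> norm (D x)"
    by (auto simp: bdd_below_op_def D_def)
  define e where "e = c\<^sup>2 / (B + \<bar>?m\<bar>)"
  have BB: "B + \<bar>?m\<bar> > 0" and e: "e > 0" using B c by (simp_all add: e_def add_pos_nonneg)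
  obtain y where y: "y \<in> K" "y \<noteq> 0" using nz zero_mem by blast
  have "?m + e \<le> ?m"
  proof -
    have "?m + e \<le> ri x (A x)" if x: "x \<in> K" "norm x = 1" for x
    proof -
      have "c\<^sup>2 \<le> (norm (D x))\<^sup>2" using c(2)[OF x(1)] x(2) c(1) by (intro power_mono) auto
      also have "\<dots> \<le> (B + \<bar>?m\<bar>) * ri x (D x)"
        by (rule positive_form_inner[OF pos D DB x(1)])
      finally have "e \<le> ri x (D x)" using BB by (simp add: e_def field_simps)
      then show ?thesis using x by (simp add: D_def ri_simps ri_same)
    qed
    moreover have "(1 / norm y) *\<^sub>R y \<in> {x \<in> K. norm x = 1}" using y by (simp add: scaleR_mem)
    ultimately show ?thesis
      unfolding num_inf_def by (intro cINF_greatest) auto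
  qed
  then show False using e by simp
qed

text \<open>The Lax-Milgram argument: solutions are the fixed points of
  \<open>x - s *\<^sub>R (A x - y)\<close>, which is a contraction for a suitable
  \<open>s > 0\<close>.\<close>

lemma coercive_bijective:
  assumes A: "A \<in> bounded_ops K" and d: "0 < d" "\<And>x. x \<in> K \<Longrightarrow> d * (norm x)\<^sup>2 \<le> ri x (A x)"
    and y: "y \<in> K"
  shows "\<exists>!x. x \<in> K \<and> A x = y"
proof -
  obtain B0 where B0: "B0 > 0" "\<And>x. x \<in> K \<Longrightarrow> norm (A x) \<le> B0 * norm x"
    using bounded_ops_bound[OF A] by blast
  \<comment> \<open>Adding \<open>d\<close> forces \<open>d < B\<close>, so that the squared
    contraction factor \<open>c\<close> lies in \<open>[0, 1)\<close>. The step
    \<open>s = d / B\<^sup>2\<close> minimizes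
    \<open>1 - 2 * s * d + s\<^sup>2 * B\<^sup>2\<close>.\<close>
  define B where "B = B0 + d"
  have B: "d < B" "norm (A x) \<le> B * norm x" if "x \<in> K" for x
    using B0(1) B0(2)[OF that] d(1) by (simp_all add: B_def algebra_simps add_increasing2)
  define s where "s = d / B\<^sup>2"
  define c where "c = 1 - (d / B)\<^sup>2"
  have B00: "d < B" "B > 0" using d B0 by (auto simp: B_def)
  have s: "0 < s" using d B00 by (simp add: s_def)
  have c: "0 \<le> c" "c < 1" using d B00 by (auto simp: c_def power_le_one)
  define g where "g x = x - s *\<^sub>R (A x - y)" for x
  have contr: "dist (g u) (g v) \<le> sqrt c * dist u v" if uv: "u \<in> K" "v \<in> K" for u v
  proof -
    define z where "z = u - v"
    have z: "z \<in> K" using uv by (simp add: z_def diff_mem)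
    have "g u - g v = z - s *\<^sub>R A z"
      using uv by (simp add: g_def z_def bounded_ops_diff[OF A] algebra_simps)
    then have "(norm (g u - g v))\<^sup>2 = (norm z)\<^sup>2 - 2 * s * ri z (A z) + s\<^sup>2 * (norm (A z))\<^sup>2"
      by (simp add: norm_diff_sq ri_simps power_mult_distrib)
    also have "\<dots> \<le> (norm z)\<^sup>2 - 2 * s * (d * (norm z)\<^sup>2) + s\<^sup>2 * (B * norm z)\<^sup>2"
      using s d(2)[OF z] B(2)[OF z] by (intro add_mono diff_mono mult_left_mono power_mono) auto
    also have "\<dots> = c * (norm z)\<^sup>2"
      using B00 by (simp add: c_def s_def power_mult_distrib power_divide field_simps power2_eq_square)
    finally have "norm (g u - g v) \<le> sqrt (c * (norm z)\<^sup>2)" by (rule real_le_rsqrt)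
    then show ?thesis by (simp add: real_sqrt_mult dist_norm z_def)
  qed
  have "\<exists>!x\<in>K. g x = x"
  proof (rule Banach_fix[OF complete_K])
    show "sqrt c < 1" "0 \<le> sqrt c" using c by auto
    show "g ` K \<subseteq> K" using y by (auto simp: g_def intro!: diff_mem scaleR_mem bounded_ops_mem[OF A])
  qed (use zero_mem contr in auto)
  moreover have "g x = x \<longleftrightarrow> A x = y" for x using s by (simp add: g_def)
  ultimately show ?thesis by simp
qed

end

section \<open>Polynomial calculus of one self-adjoint operator\<close>

locale sa_operator = closed_csubspace K for K :: "'a::chilbert_space set" +
  fixes T assumes T: "T \<in> self_adjoint_ops K"
begin

abbreviation opp :: "real poly \<Rightarrow> 'a \<Rightarrow> 'a" where "opp p \<equiv> op_poly K p T"

abbreviation rspec :: "real set" where "rspec \<equiv> {t. complex_of_real t \<in> op_spectrum K T}"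

lemmas T_bounded = self_adjoint_imp_bounded_ops[OF T]
lemmas T_mem = bounded_ops_mem[OF T_bounded]

lemma opp_undefined: "x \<notin> K \<Longrightarrow> opp p x = undefined"
  by (simp add: op_poly_def)

lemma opp_altdef:
  assumes "x \<in> K" "degree p \<le> n"
  shows "opp p x = (\<Sum>i\<le>n. coeff p i *\<^sub>R (T ^^ i) x)"
proof -
  have "(\<Sum>i\<le>degree p. coeff p i *\<^sub>R (T ^^ i) x) = (\<Sum>i\<le>n. coeff p i *\<^sub>R (T ^^ i) x)"
    using assms(2) by (intro sum.mono_neutral_left) (auto simp: coeff_eq_0)
  with assms(1) show ?thesis by (simp add: op_poly_def)
qed

lemma opp_add: "x \<in> K \<Longrightarrow> opp (p + q) x = opp p x + opp q x"
  by (simp add: opp_altdef[where n = "max (degree p) (degree q)"] degree_add_le_max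
      scaleR_left.add sum.distrib)

lemma opp_smult: "x \<in> K \<Longrightarrow> opp (smult c p) x = c *\<^sub>R opp p x"
  by (simp add: opp_altdef[where n = "degree p"] degree_smult_le scaleR_sum_right)

lemma opp_0: "x \<in> K \<Longrightarrow> opp 0 x = 0"
  by (simp add: op_poly_def)

lemma opp_diff: "x \<in> K \<Longrightarrow> opp (p - q) x = opp p x - opp q x"
  using opp_add[of x p "smult (-1) q"] opp_smult[of x "-1" q] by simp

lemma opp_pCons: "x \<in> K \<Longrightarrow> opp (pCons a p) x = a *\<^sub>R x + opp p (T x)"
proof -
  assume x: "x \<in> K"
  have "opp (pCons a p) x = (\<Sum>i\<le>Suc (degree p). coeff (pCons a p) i *\<^sub>R (T ^^ i) x)"
    using x by (rule opp_altdef) (simp add: degree_pCons_le)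
  also have "\<dots> = a *\<^sub>R x + opp p (T x)"
    using x by (subst sum.atMost_Suc_shift) (simp add: opp_altdef[OF T_mem order.refl] funpow_swap1)
  finally show ?thesis .
qed

lemma opp_commute_T: "x \<in> K \<Longrightarrow> opp p x \<in> K \<and> opp p (T x) = T (opp p x)"
proof (induction p arbitrary: x)
  case 0
  then show ?case by (simp add: opp_0 T_mem zero_mem bounded_ops_zero[OF T_bounded])
next
  case (pCons a p)
  then show ?case
    by (simp add: opp_pCons T_mem add_mem scaleR_mem bounded_ops_add[OF T_bounded]
        bounded_ops_scaleR[OF T_bounded])
qed

lemma opp_mem: "x \<in> K \<Longrightarrow> opp p x \<in> K"
  by (simp add: opp_commute_T)

lemma opp_pCons': "x \<in> K \<Longrightarrow> opp (pCons a p) x = a *\<^sub>R x + T (opp p x)"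
  by (simp add: opp_pCons opp_commute_T)

lemma opp_mult: "x \<in> K \<Longrightarrow> opp (p * q) x = opp p (opp q x)"
proof (induction p)
  case (pCons a p)
  then have "opp (pCons a p * q) x = a *\<^sub>R opp q x + T (opp (p * q) x)"
    by (simp add: opp_add opp_smult opp_pCons')
  with pCons show ?case by (simp add: opp_pCons' opp_mem)
qed (simp add: opp_0 opp_mem)

lemma opp_const: "x \<in> K \<Longrightarrow> opp [:c:] x = c *\<^sub>R x"
  by (simp add: opp_pCons opp_0 T_mem)

lemma opp_linear: "x \<in> K \<Longrightarrow> opp [:b, a:] x = b *\<^sub>R x + a *\<^sub>R T x"
  by (simp add: opp_pCons opp_0 T_mem)

lemma opp_self_adjoint: "opp p \<in> self_adjoint_ops K"
proof (induction p)
  case 0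
  show ?case
    by (rule self_adjoint_opsI[where B = 0])
      (simp_all add: opp_0 opp_undefined zero_mem add_mem scaleC_mem
        cinner_scaleR_left[of 0 0, simplified] cinner_scaleR_right[of _ 0 0, simplified])
next
  case (pCons a p)
  note ob = self_adjoint_imp_bounded_ops[OF pCons(2)]
  obtain B where B: "B > 0" "\<And>x. x \<in> K \<Longrightarrow> norm (T x) \<le> B * norm x"
    using bounded_ops_bound[OF T_bounded] by blast
  obtain D where D: "D > 0" "\<And>x. x \<in> K \<Longrightarrow> norm (opp p x) \<le> D * norm x"
    using bounded_ops_bound[OF ob] by blast
  show ?case
  proof (rule self_adjoint_opsI[where B = "\<bar>a\<bar> + B * D"])
    fix x y c assume x: "x \<in> K"
    show "opp (pCons a p) x \<in> K" using x by (rule opp_mem)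
    show "opp (pCons a p) (c *\<^sub>C x) = c *\<^sub>C opp (pCons a p) x"
      using x by (simp add: opp_pCons' scaleC_mem bounded_ops_scaleC[OF T_bounded] opp_mem
          bounded_ops_scaleC[OF ob] scaleC_add_right scaleC_of_real[symmetric] scaleC_scaleC mult.commute)
    have "norm (T (opp p x)) \<le> B * (D * norm x)"
      using B(2)[OF opp_mem[OF x]] mult_left_mono[OF D(2)[OF x], of B] B(1)
      by (meson less_imp_le order.trans)
    then show "norm (opp (pCons a p) x) \<le> (\<bar>a\<bar> + B * D) * norm x"
      using x norm_triangle_ineq[of "a *\<^sub>R x" "T (opp p x)"]
      by (simp add: opp_pCons' algebra_simps)
    assume y: "y \<in> K"
    show "opp (pCons a p) (x + y) = opp (pCons a p) x + opp (pCons a p) y"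
      using x y by (simp add: opp_pCons' add_mem bounded_ops_add[OF ob] bounded_ops_add[OF T_bounded]
          opp_mem scaleR_add_right)
    \<comment> \<open>Moving \<open>T\<close> and \<open>opp p\<close> across reverses their order;
      they commute by \<open>opp_commute_T\<close>.\<close>
    show "cinner (opp (pCons a p) x) y = cinner x (opp (pCons a p) y)"
      using x y self_adjoint_cinner[OF T opp_mem[OF x] y] self_adjoint_cinner[OF pCons(2) x T_mem[OF y]]
      by (simp add: opp_pCons' cinner_add_left cinner_add_right cinner_scaleR_left cinner_scaleR_right
          opp_commute_T)
  qed (simp add: opp_undefined)
qed

lemmas opp_bounded = self_adjoint_imp_bounded_ops[OF opp_self_adjoint]

lemma bdd_below_linear:
  assumes "a \<notin> rspec"
  shows "bdd_below_op (opp [:- a, 1:])"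
proof -
  obtain S where S: "S \<in> bounded_ops K" "\<And>x. x \<in> K \<Longrightarrow> S (T x - a *\<^sub>R x) = x"
    using assms by (auto simp: op_spectrum_def scaleC_of_real)
  obtain B where B: "B > 0" "\<And>x. x \<in> K \<Longrightarrow> norm (S x) \<le> B * norm x"
    using bounded_ops_bound[OF S(1)] by blast
  have "1 / B * norm x \<le> norm (opp [:- a, 1:] x)" if x: "x \<in> K" for x
    using B(2)[of "T x - a *\<^sub>R x"] S(2)[OF x] x B(1)
    by (simp add: diff_mem T_mem scaleR_mem opp_linear field_simps)
  then show ?thesis using B(1) unfolding bdd_below_op_def by (intro exI[of _ "1 / B"]) auto
qed

text \<open>The quadratic form at \<open>x\<close> is \<open>\<parallel>(T - a) x\<parallel>^2 + b^2
  \<parallel>x\<parallel>^2\<close>, so a pair of non-real roots never obstructs a lower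
  bound.\<close>

lemma bdd_below_quadratic:
  assumes "b \<noteq> 0"
  shows "bdd_below_op (opp ([:- a, 1:]\<^sup>2 + [:b\<^sup>2:]))"
proof -
  have "b\<^sup>2 * norm x \<le> norm (opp ([:- a, 1:]\<^sup>2 + [:b\<^sup>2:]) x)" if x: "x \<in> K" for x
  proof (cases "x = 0")
    case False
    let ?q = "opp [:- a, 1:]"
    have "ri x (opp ([:- a, 1:]\<^sup>2 + [:b\<^sup>2:]) x) = ri x (?q (?q x)) + b\<^sup>2 * (norm x)\<^sup>2"
      unfolding power2_eq_square using x
      by (simp only: opp_add opp_mult opp_const) (simp add: ri_simps ri_same power2_eq_square)
    also have "ri x (?q (?q x)) = (norm (?q x))\<^sup>2"
      using self_adjoint_ri[OF opp_self_adjoint x opp_mem[OF x], of "[:- a, 1:]" "[:- a, 1:]"]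
      by (simp add: ri_same)
    finally have "b\<^sup>2 * (norm x)\<^sup>2 \<le> norm x * norm (opp ([:- a, 1:]\<^sup>2 + [:b\<^sup>2:]) x)"
      using ri_le_norm[of x "opp ([:- a, 1:]\<^sup>2 + [:b\<^sup>2:]) x"] zero_le_power2[of "norm (?q x)"]
      by linarith
    then have "norm x * (b\<^sup>2 * norm x) \<le> norm x * norm (opp ([:- a, 1:]\<^sup>2 + [:b\<^sup>2:]) x)"
      by (simp add: power2_eq_square mult_ac)
    then show ?thesis using False by simp
  qed simp
  then show ?thesis using assms unfolding bdd_below_op_def by (intro exI[of _ "b\<^sup>2"]) auto
qed

end

section \<open>Factorisation of real polynomials\<close>

lemma map_poly_of_real_add:
  "map_poly complex_of_real (p + q) = map_poly of_real p + map_poly of_real q"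
  by (rule poly_eqI) (simp add: coeff_map_poly)

lemma map_poly_of_real_mult:
  "map_poly complex_of_real (p * q) = map_poly of_real p * map_poly of_real q"
proof (induction p)
  case (pCons a p)
  have "map_poly complex_of_real (smult a q) = smult (of_real a) (map_poly of_real q)"
    by (rule poly_eqI) (simp add: coeff_map_poly)
  with pCons show ?case by (simp add: map_poly_of_real_add map_poly_pCons)
qed simp

lemma poly_map_poly_of_real:
  "poly (map_poly complex_of_real p) (of_real x) = of_real (poly p x)"
  by (induction p) (simp_all add: map_poly_pCons)

text \<open>A complex root \<open>z\<close> exists. If it is not real, divide by the real quadratic
  with roots \<open>z\<close> and its conjugate: the remainder is a real linear polynomial vanishing
  at a non-real point, hence zero.\<close>

lemma real_poly_factor:
  fixes q :: "real poly"
  assumes deg: "degree q > 0"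
  shows "(\<exists>a r. q = [:- a, 1:] * r) \<or> (\<exists>a b r. b \<noteq> 0 \<and> q = ([:- a, 1:]\<^sup>2 + [:b\<^sup>2:]) * r)"
proof -
  let ?m = "map_poly complex_of_real"
  have "\<not> constant (poly (?m q))"
  proof -
    have "degree (?m q) \<noteq> 0" using deg by (simp add: degree_map_poly)
    then show ?thesis by (simp add: constant_degree)
  qed
  then obtain z where z: "poly (?m q) z = 0"
    using fundamental_theorem_of_algebra by blast
  define a b where "a = Re z" and "b = Im z"
  show ?thesis
  proof (cases "b = 0")
    case True
    then have "z = complex_of_real a" by (simp add: a_def b_def complex_eq_iff)
    then have "poly q a = 0" using z by (simp add: poly_map_poly_of_real)
    then show ?thesis by (auto simp: poly_eq_0_iff_dvd dvd_def)
  next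
    case False
    define d where "d = [:- a, 1:]\<^sup>2 + [:b\<^sup>2:]"
    have d: "d = [:a\<^sup>2 + b\<^sup>2, - 2 * a, 1:]" by (simp add: d_def power2_eq_square)
    have dz: "poly (?m d) z = 0"
      by (simp add: d map_poly_pCons a_def b_def complex_eq_iff power2_eq_square algebra_simps)
    define r where "r = q mod d"
    have "degree r < 2"
      using degree_mod_less[of d q] by (auto simp: d r_def)
    then obtain u v where r: "r = [:u, v:]"
      by (intro that[of "coeff r 0" "coeff r 1"] poly_eqI)
        (auto simp: coeff_pCons coeff_eq_0 split: nat.splits)
    have q: "q = d * (q div d) + r" by (simp add: r_def)
    have "?m q = ?m d * ?m (q div d) + ?m r"
      by (subst q) (simp only: map_poly_of_real_add map_poly_of_real_mult)
    then have "poly (?m r) z = 0" using z dz by simp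
    then have "u + v * a = 0" "v * b = 0"
      by (simp_all add: r map_poly_pCons a_def b_def complex_eq_iff mult.commute)
    then have "r = 0" using False by (simp add: r)
    then have "q = d * (q div d)" using q by simp
    with False show ?thesis unfolding d_def by blast
  qed
qed

section \<open>Spectral bounds for polynomials in an operator\<close>

context sa_operator
begin

text \<open>Real factors are split off one at a time: a linear one has its root outside the
  spectrum, and a quadratic one is covered by \<open>bdd_below_quadratic\<close>.\<close>

lemma bdd_below_poly:
  assumes "q \<noteq> 0" "\<And>t. t \<in> rspec \<Longrightarrow> poly q t \<noteq> 0"
  shows "bdd_below_op (opp q)"
  using assms
proof (induction "degree q" arbitrary: q rule: less_induct)
  case less
  have step: "bdd_below_op (opp q)"
    if q: "q = s * r" and s: "bdd_below_op (opp s)" "degree s > 0" for s r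
  proof -
    have r: "r \<noteq> 0" "s \<noteq> 0" using less.prems(1) q by auto
    have "bdd_below_op (opp r)"
    proof (rule less.hyps)
      show "degree r < degree q" using r s(2) q by (simp add: degree_mult_eq)
      show "poly r t \<noteq> 0" if "t \<in> rspec" for t using less.prems(2)[OF that] q by auto
    qed (rule r)
    then have "bdd_below_op (\<lambda>x. opp s (opp r x))"
      by (rule bdd_below_op_comp[OF s(1) _ opp_mem])
    moreover have "bdd_below_op (opp q) = bdd_below_op (\<lambda>x. opp s (opp r x))"
      by (rule bdd_below_op_cong) (simp add: q opp_mult)
    ultimately show ?thesis by simp
  qed
  show ?case
  proof (cases "degree q > 0")
    case False
    then obtain c where c: "q = [:c:]" by (metis degree_eq_zeroE gr0I)
    then have "c \<noteq> 0" using less.prems(1) by simp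
    then show ?thesis
      unfolding bdd_below_op_def by (intro exI[of _ "\<bar>c\<bar>"]) (simp add: c opp_const)
  next
    case True
    from real_poly_factor[OF this] show ?thesis
    proof (elim disjE exE conjE)
      fix a r assume q: "q = [:- a, 1:] * r"
      then have "poly q a = 0" by simp
      then have "a \<notin> rspec" using less.prems(2) by blast
      then show ?thesis by (intro step[OF q] bdd_below_linear) auto
    next
      fix a b r assume b: "b \<noteq> 0" and q: "q = ([:- a, 1:]\<^sup>2 + [:b\<^sup>2:]) * r"
      show ?thesis by (intro step[OF q] bdd_below_quadratic b) (simp add: power2_eq_square)
    qed
  qed
qed

text \<open>The half of spectral mapping needed for positivity: \<open>opp p\<close> minus the lower
  end of its numerical range is not bounded below, so by \<open>bdd_below_poly\<close> the
  polynomial \<open>p\<close> takes that value on the spectrum.\<close>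

lemma num_inf_root:
  assumes "K \<noteq> {0}"
  shows "\<exists>t\<in>rspec. poly p t = num_inf (opp p)"
proof -
  have root: "p - [:num_inf (opp p):] = 0 \<or> (\<exists>t\<in>rspec. poly p t = num_inf (opp p))" for p
  proof (rule ccontr)
    assume "\<not> ?thesis"
    then have "bdd_below_op (opp (p - [:num_inf (opp p):]))"
      by (intro bdd_below_poly) (auto simp del: mem_Collect_eq)
    moreover have "bdd_below_op (opp (p - [:num_inf (opp p):]))
        = bdd_below_op (\<lambda>x. opp p x - num_inf (opp p) *\<^sub>R x)"
      by (rule bdd_below_op_cong) (simp add: opp_diff opp_const)
    ultimately have "bdd_below_op (\<lambda>x. opp p x - num_inf (opp p) *\<^sub>R x)" by simp
    with num_inf_not_bdd_below[OF opp_self_adjoint assms] show False by blast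
  qed
  \<comment> \<open>If \<open>p\<close> is constant, any spectral point serves; applying
    \<open>root\<close> to the non-constant \<open>[:0, 1:]\<close> supplies one.\<close>
  obtain t where "t \<in> rspec" using root[of "[:0, 1:]"] by auto
  moreover have "poly p t = num_inf (opp p)" if "p - [:num_inf (opp p):] = 0"
    using arg_cong[OF that, of "\<lambda>q. poly q t"] by simp
  ultimately show ?thesis using root[of p] by blast
qed

lemma opp_nonneg:
  assumes "\<And>t. t \<in> rspec \<Longrightarrow> 0 \<le> poly p t" "x \<in> K"
  shows "0 \<le> ri x (opp p x)"
proof (cases "K = {0}")
  case False
  have "0 \<le> num_inf (opp p)" using num_inf_root[OF False, of p] assms(1) by force
  then show ?thesis
    using num_inf_le[OF opp_self_adjoint assms(2), of p]
    by (meson order.trans zero_le_mult_iff zero_le_power2)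
qed (use assms(2) in \<open>simp add: ri_simps\<close>)

text \<open>Positivity applied to \<open>c\<^sup>2 - p\<^sup>2\<close>, which is nonnegative on the
  spectrum.\<close>

lemma norm_opp_le:
  assumes "\<And>t. t \<in> rspec \<Longrightarrow> \<bar>poly p t\<bar> \<le> c" "0 \<le> c" "x \<in> K"
  shows "norm (opp p x) \<le> c * norm x"
proof -
  have "0 \<le> ri x (opp ([:c\<^sup>2:] - p * p) x)"
  proof (rule opp_nonneg[OF _ assms(3)])
    fix t assume "t \<in> rspec"
    then have "(poly p t)\<^sup>2 \<le> c\<^sup>2" using assms(1,2) by (simp add: power2_le_iff_abs_le)
    then show "0 \<le> poly ([:c\<^sup>2:] - p * p) t" by (simp add: power2_eq_square)
  qed
  also have "\<dots> = c\<^sup>2 * (norm x)\<^sup>2 - ri x (opp p (opp p x))"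
    using assms(3) by (simp only: opp_diff opp_mult opp_const) (simp add: ri_simps ri_same)
  also have "ri x (opp p (opp p x)) = (norm (opp p x))\<^sup>2"
    using self_adjoint_ri[OF opp_self_adjoint assms(3) opp_mem[OF assms(3)], of p p] by (simp add: ri_same)
  finally have "(norm (opp p x))\<^sup>2 \<le> (c * norm x)\<^sup>2" by (simp add: power_mult_distrib)
  then show ?thesis using assms(2) by (auto intro: power2_le_imp_le)
qed

text \<open>Outside \<open>[lo, hi]\<close> one of \<open>T - a\<close> and \<open>a - T\<close> is
  coercive, with the distance of \<open>a\<close> to the violated bound as constant, so
  \<open>coercive_bijective\<close> yields a bounded inverse.\<close>

lemma rspec_bounds:
  assumes lo: "\<And>x. x \<in> K \<Longrightarrow> lo * (norm x)\<^sup>2 \<le> ri x (T x)"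
    and hi: "\<And>x. x \<in> K \<Longrightarrow> ri x (T x) \<le> hi * (norm x)\<^sup>2"
  shows "rspec \<subseteq> {lo..hi}"
proof
  fix a assume a: "a \<in> rspec"
  show "a \<in> {lo..hi}"
  proof (rule ccontr)
    assume out: "a \<notin> {lo..hi}"
    \<comment> \<open>The sign that makes \<open>e *\<^sub>R (T x - a *\<^sub>R x)\<close>
      coercive.\<close>
    define e where "e = (if a < lo then 1 else - 1 :: real)"
    define d where "d = (if a < lo then lo - a else a - hi)"
    define A where "A = opp [:- (e * a), e:]"
    have Ax: "A x = e *\<^sub>R (T x - a *\<^sub>R x)" if "x \<in> K" for x
      using that by (simp add: A_def opp_linear algebra_simps)
    have ee: "e * e = 1" and d: "0 < d" using out by (auto simp: e_def d_def)
    have A: "A \<in> bounded_ops K" unfolding A_def by (rule opp_bounded)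
    have coer: "d * (norm x)\<^sup>2 \<le> ri x (A x)" if "x \<in> K" for x
      using lo[OF that] hi[OF that] that by (auto simp: Ax ri_simps ri_same d_def e_def algebra_simps)
    have ex1: "\<exists>!x. x \<in> K \<and> A x = y" if "y \<in> K" for y
      by (rule coercive_bijective[OF A d coer that])
    define R where "R = (\<lambda>y\<in>K. THE x. x \<in> K \<and> A x = y)"
    have R: "R y \<in> K" "A (R y) = y" if "y \<in> K" for y
      using theI'[OF ex1[OF that]] that by (auto simp: R_def)
    have R_eq: "R (A x) = x" if "x \<in> K" for x
      using ex1[OF bounded_ops_mem[OF A that]] R[OF bounded_ops_mem[OF A that]] that by blast
    have R_add: "R (x + y) = R x + R y" if "x \<in> K" "y \<in> K" for x y
      using R_eq[of "R x + R y"] R that by (simp add: add_mem bounded_ops_add[OF A])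
    have R_scale: "R (c *\<^sub>C x) = c *\<^sub>C R x" if "x \<in> K" for x c
      using R_eq[of "c *\<^sub>C R x"] R that by (simp add: scaleC_mem bounded_ops_scaleC[OF A])
    have R_bound: "norm (R y) \<le> 1 / d * norm y" if y: "y \<in> K" for y
    proof (cases "R y = 0")
      case False
      have "d * (norm (R y))\<^sup>2 \<le> norm (R y) * norm y"
        using coer[OF R(1)[OF y]] ri_le_norm[of "R y" y] R(2)[OF y] by simp
      then show ?thesis using False d by (simp add: power2_eq_square field_simps)
    qed (use d in simp)
    \<comment> \<open>\<open>R\<close> inverts \<open>A = e (T - a)\<close>; since
      \<open>e * e = 1\<close>, multiplying by \<open>e\<close> gives the inverse of
      \<open>T - a\<close> itself.\<close>
    define S where "S = (\<lambda>y\<in>K. e *\<^sub>R R y)"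
    have "S \<in> bounded_ops K"
      unfolding bounded_ops_def
    proof (intro CollectI conjI ballI allI exI)
      show "S \<in> K \<rightarrow>\<^sub>E K" using R by (auto simp: S_def scaleR_mem)
      fix x assume x: "x \<in> K"
      show "norm (S x) \<le> 1 / d * norm x"
        using R_bound[OF x] x by (simp add: S_def e_def)
      show "S (c *\<^sub>C x) = c *\<^sub>C S x" for c
        using x by (simp add: S_def scaleC_mem R_scale scaleC_of_real[symmetric] scaleC_scaleC mult.commute)
      show "S (x + y) = S x + S y" if "y \<in> K" for y
        using x that by (simp add: S_def add_mem R_add scaleR_add_right)
    qed
    moreover have "S (T x - a *\<^sub>R x) = x \<and> T (S x) - a *\<^sub>R S x = x" if x: "x \<in> K" for x
    proof
      have *: "T x - a *\<^sub>R x = A (e *\<^sub>R x)"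
        using x by (simp add: bounded_ops_scaleR[OF A] Ax ee)
      then show "S (T x - a *\<^sub>R x) = x"
        using x R_eq[of "e *\<^sub>R x"] ee by (simp add: S_def scaleR_mem bounded_ops_mem[OF A])
      have "T (S x) - a *\<^sub>R S x = A (R x)"
        using x R(1)[OF x] by (simp add: S_def Ax bounded_ops_scaleR[OF T_bounded] algebra_simps)
      then show "T (S x) - a *\<^sub>R S x = x" using R(2)[OF x] by simp
    qed
    ultimately have "a \<notin> rspec" by (auto simp: op_spectrum_def scaleC_of_real)
    with a show False by blast
  qed
qed

end

section \<open>The continuous functional calculus\<close>

lemma uniform_limit_polynomials:
  fixes g :: "real \<Rightarrow> real"
  assumes "continuous_on {lo..hi} g"
  obtains p where "uniform_limit {lo..hi} (\<lambda>n. poly (p n)) g sequentially"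
proof -
  have "\<exists>p. \<forall>t\<in>{lo..hi}. \<bar>g t - poly p t\<bar> < 1 / real (Suc n)" for n
  proof -
    obtain h where h: "real_polynomial_function h" "\<And>t. t \<in> {lo..hi} \<Longrightarrow> \<bar>g t - h t\<bar> < 1 / real (Suc n)"
      by (rule Stone_Weierstrass_real_polynomial_function[OF compact_Icc assms, of "1 / real (Suc n)"])
        (simp, blast)
    obtain a m where "h = (\<lambda>x. \<Sum>i\<le>m. a i * x ^ i)"
      using h(1) by (auto simp: real_polynomial_function_iff_sum)
    then have "h t = poly (\<Sum>i\<le>m. monom (a i) i) t" for t by (simp add: poly_sum poly_monom)
    with h(2) show ?thesis by metis
  qed
  then obtain p where p: "\<And>n t. t \<in> {lo..hi} \<Longrightarrow> \<bar>g t - poly (p n) t\<bar> < 1 / real (Suc n)"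
    by metis
  show ?thesis
  proof (rule that, rule uniform_limitI)
    fix e :: real assume "e > 0"
    then have "\<forall>\<^sub>F n in sequentially. inverse (real (Suc n)) < e"
      by (rule order_tendstoD(2)[OF LIMSEQ_inverse_real_of_nat])
    then show "\<forall>\<^sub>F n in sequentially. \<forall>x\<in>{lo..hi}. dist (poly (p n) x) (g x) < e"
    proof eventually_elim
      case (elim n)
      show ?case
      proof
        fix t assume "t \<in> {lo..hi}"
        then show "dist (poly (p n) t) (g t) < e"
          using p[of t n] elim by (simp add: dist_real_def abs_minus_commute inverse_eq_divide)
      qed
    qed
  qed
qed

context sa_operator
begin

lemma norm_opp_diff_le:
  assumes "\<And>t. t \<in> rspec \<Longrightarrow> \<bar>poly p t - poly q t\<bar> \<le> c" "0 \<le> c" "x \<in> K"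
  shows "norm (opp p x - opp q x) \<le> c * norm x"
  using norm_opp_le[of "p - q" c x] assms by (simp add: opp_diff)

text \<open>By \<open>norm_opp_le\<close>, uniform Cauchyness on the spectrum becomes Cauchyness in
  operator norm. Linearity and symmetry pass to the pointwise limit.\<close>

lemma opp_uniform_limit:
  assumes p: "uniform_limit rspec (\<lambda>n. poly (p n)) g sequentially"
  obtains S where "S \<in> self_adjoint_ops K"
    "\<And>e. e > 0 \<Longrightarrow> \<exists>N. \<forall>n\<ge>N. \<forall>x\<in>K. norm (opp (p n) x - S x) \<le> e * norm x"
proof -
  have cauchy: "\<exists>N. \<forall>m\<ge>N. \<forall>n\<ge>N. \<forall>x\<in>K. norm (opp (p m) x - opp (p n) x) \<le> e * norm x"
    if e: "e > 0" for e
  proof -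
    obtain N where N: "\<And>n t. n \<ge> N \<Longrightarrow> t \<in> rspec \<Longrightarrow> dist (poly (p n) t) (g t) < e / 2"
      using p e unfolding uniform_limit_sequentially_iff by (meson half_gt_zero)
    have "norm (opp (p m) x - opp (p n) x) \<le> e * norm x" if mn: "m \<ge> N" "n \<ge> N" and "x \<in> K" for m n x
    proof (rule norm_opp_diff_le)
      fix t assume t: "t \<in> rspec"
      show "\<bar>poly (p m) t - poly (p n) t\<bar> \<le> e"
        using N[OF mn(1) t] N[OF mn(2) t] unfolding dist_real_def by linarith
    qed (use e that in auto)
    then show ?thesis by blast
  qed
  have conv: "\<exists>l\<in>K. (\<lambda>n. opp (p n) x) \<longlonglongrightarrow> l" if x: "x \<in> K" for x
  proof -
    have "Cauchy (\<lambda>n. opp (p n) x)"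
    proof (rule metric_CauchyI)
      fix e :: real assume e: "e > 0"
      define c where "c = e / (norm x + 1)"
      have c: "c > 0" "c * norm x < e"
        using e add_nonneg_pos[OF norm_ge_zero[of x] zero_less_one]
        by (simp_all add: c_def divide_less_eq algebra_simps)
      obtain N where N: "\<And>m n. m \<ge> N \<Longrightarrow> n \<ge> N \<Longrightarrow> norm (opp (p m) x - opp (p n) x) \<le> c * norm x"
        using cauchy[OF c(1)] x by blast
      show "\<exists>N. \<forall>m\<ge>N. \<forall>n\<ge>N. dist (opp (p m) x) (opp (p n) x) < e"
      proof (intro exI allI impI)
        fix m n assume "m \<ge> N" "n \<ge> N"
        from le_less_trans[OF N[OF this] c(2)] show "dist (opp (p m) x) (opp (p n) x) < e"
          by (simp only: dist_norm)
      qed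
    qed
    then show ?thesis
      using complete_K[unfolded complete_def, rule_format, of "\<lambda>n. opp (p n) x"] opp_mem[OF x]
      by blast
  qed
  define S where "S = (\<lambda>x\<in>K. lim (\<lambda>n. opp (p n) x))"
  have S: "S x \<in> K" "(\<lambda>n. opp (p n) x) \<longlonglongrightarrow> S x" if "x \<in> K" for x
    using conv[OF that] that by (auto simp: S_def limI)
  have close: "\<exists>N. \<forall>n\<ge>N. \<forall>x\<in>K. norm (opp (p n) x - S x) \<le> e * norm x" if e: "e > 0" for e
  proof -
    obtain N where N: "\<And>m n x. m \<ge> N \<Longrightarrow> n \<ge> N \<Longrightarrow> x \<in> K \<Longrightarrow> norm (opp (p m) x - opp (p n) x) \<le> e * norm x"
      using cauchy[OF e] by blast
    have "norm (opp (p n) x - S x) \<le> e * norm x" if "n \<ge> N" "x \<in> K" for n x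
    proof (rule tendsto_upperbound)
      show "(\<lambda>m. norm (opp (p n) x - opp (p m) x)) \<longlonglongrightarrow> norm (opp (p n) x - S x)"
        by (intro tendsto_intros S that)
      show "\<forall>\<^sub>F m in sequentially. norm (opp (p n) x - opp (p m) x) \<le> e * norm x"
        using eventually_ge_at_top[of N] by eventually_elim (rule N[OF that(1) _ that(2)])
    qed simp
    then show ?thesis by blast
  qed
  obtain N where N: "\<And>x. x \<in> K \<Longrightarrow> norm (opp (p N) x - S x) \<le> 1 * norm x"
    using close[OF zero_less_one] by blast
  obtain B where B: "\<And>x. x \<in> K \<Longrightarrow> norm (opp (p N) x) \<le> B * norm x"
    using bounded_ops_bound[OF opp_bounded[of "p N"]] by blast
  have sym: "ri (S x) y = ri x (S y)" if "x \<in> K" "y \<in> K" for x y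
  proof (rule LIMSEQ_unique)
    show "(\<lambda>n. ri (opp (p n) x) y) \<longlonglongrightarrow> ri (S x) y" by (intro tendsto_ri S that tendsto_const)
    show "(\<lambda>n. ri (opp (p n) x) y) \<longlonglongrightarrow> ri x (S y)"
      unfolding self_adjoint_ri[OF opp_self_adjoint that] by (intro tendsto_ri S that tendsto_const)
  qed
  have scale: "S (c *\<^sub>C x) = c *\<^sub>C S x" if "x \<in> K" for c x
  proof (rule LIMSEQ_unique)
    show "(\<lambda>n. opp (p n) (c *\<^sub>C x)) \<longlonglongrightarrow> S (c *\<^sub>C x)" by (intro S scaleC_mem that)
    show "(\<lambda>n. opp (p n) (c *\<^sub>C x)) \<longlonglongrightarrow> c *\<^sub>C S x"
      unfolding bounded_ops_scaleC[OF opp_bounded that] by (intro tendsto_scaleC S that)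
  qed
  have "S \<in> self_adjoint_ops K"
  proof (rule self_adjoint_opsI[where B = "1 + B"])
    fix x assume x: "x \<in> K"
    show "S x \<in> K" using S(1)[OF x] .
    show "S (c *\<^sub>C x) = c *\<^sub>C S x" for c by (rule scale[OF x])
    show "norm (S x) \<le> (1 + B) * norm x"
      using N[OF x] B[OF x] norm_triangle_ineq2[of "S x" "opp (p N) x"]
      by (simp add: norm_minus_commute algebra_simps)
    fix y assume y: "y \<in> K"
    show "S (x + y) = S x + S y"
    proof (rule LIMSEQ_unique)
      show "(\<lambda>n. opp (p n) (x + y)) \<longlonglongrightarrow> S (x + y)" by (intro S add_mem x y)
      show "(\<lambda>n. opp (p n) (x + y)) \<longlonglongrightarrow> S x + S y"
        unfolding bounded_ops_add[OF opp_bounded x y] by (intro tendsto_add S x y)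
    qed
    \<comment> \<open>The complex identity follows from the real one at \<open>y\<close> and at
      \<open>\<i> *\<^sub>C y\<close>.\<close>
    show "cinner (S x) y = cinner x (S y)"
      using sym[OF x y] sym[OF x scaleC_mem[OF y, of \<i>]] scale[OF y, of \<i>]
      by (simp add: cinner_eq_ri)
  qed (simp add: S_def)
  then show ?thesis using close that by blast
qed

text \<open>Shows that the description in \<open>cfc\<close> has exactly one solution: a limit
  exists by \<open>opp_uniform_limit\<close>, and two approximating sequences become uniformly close
  on the spectrum, hence so do their operators.\<close>

lemma cfc_limit:
  assumes p: "uniform_limit rspec (\<lambda>n. poly (p n)) g sequentially"
  shows cfc_self_adjoint: "cfc K g T \<in> self_adjoint_ops K"
    and cfc_tendsto: "x \<in> K \<Longrightarrow> (\<lambda>n. opp (p n) x) \<longlonglongrightarrow> cfc K g T x"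
proof -
  obtain S where S: "S \<in> self_adjoint_ops K"
    and close: "\<And>e. e > 0 \<Longrightarrow> \<exists>N. \<forall>n\<ge>N. \<forall>x\<in>K. norm (opp (p n) x - S x) \<le> e * norm x"
    using opp_uniform_limit[OF p] by blast
  note Sb = self_adjoint_imp_bounded_ops[OF S]
  have unif: "uniform_limit (K \<inter> cball 0 1) (\<lambda>n. opp (p n)) S sequentially"
    unfolding uniform_limit_sequentially_iff
  proof (intro allI impI)
    fix e :: real assume e: "e > 0"
    then obtain N where N: "\<And>n x. n \<ge> N \<Longrightarrow> x \<in> K \<Longrightarrow> norm (opp (p n) x - S x) \<le> e / 2 * norm x"
      using close[of "e / 2"] by auto
    have "dist (opp (p n) x) (S x) < e" if "n \<ge> N" "x \<in> K \<inter> cball 0 1" for n x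
    proof -
      have "e / 2 * norm x \<le> e / 2 * 1" using that e by (intro mult_left_mono) auto
      moreover have "norm (opp (p n) x - S x) \<le> e / 2 * norm x" using N that by blast
      ultimately show ?thesis using e unfolding dist_norm by linarith
    qed
    then show "\<exists>N. \<forall>n\<ge>N. \<forall>x\<in>K \<inter> cball 0 1. dist (opp (p n) x) (S x) < e" by blast
  qed
  have unique: "S' = S" if S': "S' \<in> bounded_ops K"
    and q: "uniform_limit rspec (\<lambda>n. poly (q n)) g sequentially"
    and unif': "uniform_limit (K \<inter> cball 0 1) (\<lambda>n. opp (q n)) S' sequentially" for S' q
  proof -
    have ball: "S' x = S x" if x: "x \<in> K \<inter> cball 0 1" for x
    proof -
      have "(\<lambda>n. opp (q n) x - opp (p n) x) \<longlonglongrightarrow> 0"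
      proof (rule LIMSEQ_I)
        fix e :: real assume e: "e > 0"
        have "\<forall>\<^sub>F n in sequentially. \<forall>t\<in>rspec. dist (poly (p n) t) (g t) < e / 4"
          "\<forall>\<^sub>F n in sequentially. \<forall>t\<in>rspec. dist (poly (q n) t) (g t) < e / 4"
          using uniform_limitD[OF p, of "e / 4"] uniform_limitD[OF q, of "e / 4"] e by simp_all
        then have "\<forall>\<^sub>F n in sequentially. norm (opp (q n) x - opp (p n) x - 0) < e"
        proof eventually_elim
          case (elim n)
          have "norm (opp (q n) x - opp (p n) x) \<le> e / 2 * norm x"
          proof (rule norm_opp_diff_le)
            fix t assume "t \<in> rspec"
            then have "dist (poly (p n) t) (g t) < e / 4" "dist (poly (q n) t) (g t) < e / 4"
              using elim by blast+
            then show "\<bar>poly (q n) t - poly (p n) t\<bar> \<le> e / 2"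
              unfolding dist_real_def by linarith
          qed (use e x in auto)
          also have "\<dots> \<le> e / 2 * 1" using x e by (intro mult_left_mono) auto
          finally show ?case using e by simp
        qed
        then show "\<exists>N. \<forall>n\<ge>N. norm (opp (q n) x - opp (p n) x - 0) < e"
          by (simp only: eventually_sequentially)
      qed
      moreover have "(\<lambda>n. opp (q n) x - opp (p n) x) \<longlonglongrightarrow> S' x - S x"
        by (intro tendsto_diff tendsto_uniform_limitI[OF unif x] tendsto_uniform_limitI[OF unif' x])
      ultimately have "S' x - S x = 0" using LIMSEQ_unique by blast
      then show ?thesis by simp
    qed
    show ?thesis
    proof (rule bounded_ops_eqI[OF S' Sb])
      fix x assume x: "x \<in> K"
      \<comment> \<open>The description controls \<open>S'\<close> on the unit ball only, so
        \<open>x\<close> is scaled into it; the \<open>+ 1\<close> covers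
        \<open>x = 0\<close>.\<close>
      define y where "y = (1 / (norm x + 1)) *\<^sub>R x"
      have pos: "norm x + 1 > 0" by (simp add: add_nonneg_pos)
      have y: "y \<in> K" "norm y \<le> 1" "x = (norm x + 1) *\<^sub>R y"
        using x pos by (simp_all add: y_def scaleR_mem divide_simps)
      then have "S' y = S y" using ball by simp
      then show "S' x = S x"
        using y bounded_ops_scaleR[OF Sb y(1)] bounded_ops_scaleR[OF S' y(1)] by metis
    qed
  qed
  have "cfc K g T = S"
    unfolding cfc_def using Sb p unif unique by (intro the_equality) blast+
  then show "cfc K g T \<in> self_adjoint_ops K" using S by simp
  assume x: "x \<in> K"
  show "(\<lambda>n. opp (p n) x) \<longlonglongrightarrow> cfc K g T x"
    unfolding \<open>cfc K g T = S\<close>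
  proof (rule LIMSEQ_I)
    fix e :: real assume e: "e > 0"
    define c where "c = e / (norm x + 1)"
    have c: "c > 0" "c * norm x < e"
      using e add_nonneg_pos[OF norm_ge_zero[of x] zero_less_one]
      by (simp_all add: c_def divide_less_eq algebra_simps)
    obtain N where N: "\<And>n. n \<ge> N \<Longrightarrow> norm (opp (p n) x - S x) \<le> c * norm x"
      using close[OF c(1)] x by blast
    show "\<exists>N. \<forall>n\<ge>N. norm (opp (p n) x - S x) < e"
      using le_less_trans[OF N c(2)] by blast
  qed
qed

end

text \<open>Functions are taken continuous on an interval containing the spectrum, so that one
  function can be applied both to \<open>H\<close> and to its compression, whose spectra may
  differ.\<close>

locale sa_operator_interval = sa_operator +
  fixes lo hi :: real
  assumes rspec_subset: "rspec \<subseteq> {lo..hi}"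
begin

abbreviation J :: "real set" where "J \<equiv> {lo..hi}"

abbreviation fc :: "(real \<Rightarrow> real) \<Rightarrow> 'a \<Rightarrow> 'a" where "fc g \<equiv> cfc K g T"

lemma fc_tendsto:
  assumes "uniform_limit J (\<lambda>n. poly (p n)) g sequentially" "x \<in> K"
  shows "(\<lambda>n. opp (p n) x) \<longlonglongrightarrow> fc g x"
  by (rule cfc_tendsto[OF uniform_limit_on_subset[OF assms(1) rspec_subset] assms(2)])

lemma fc_self_adjoint:
  assumes "continuous_on J g" shows "fc g \<in> self_adjoint_ops K"
proof -
  obtain p where "uniform_limit J (\<lambda>n. poly (p n)) g sequentially"
    using uniform_limit_polynomials[OF assms] .
  from cfc_self_adjoint[OF uniform_limit_on_subset[OF this rspec_subset]] show ?thesis .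
qed

lemmas fc_bounded = self_adjoint_imp_bounded_ops[OF fc_self_adjoint]
lemmas fc_mem = bounded_ops_mem[OF fc_bounded]
lemmas fc_ri = self_adjoint_ri[OF fc_self_adjoint]

lemma fc_cong:
  assumes g: "continuous_on J g" and eq: "\<And>t. t \<in> J \<Longrightarrow> g t = h t" and x: "x \<in> K"
  shows "fc g x = fc h x"
proof -
  obtain p where p: "uniform_limit J (\<lambda>n. poly (p n)) g sequentially"
    using uniform_limit_polynomials[OF g] .
  moreover have "uniform_limit J (\<lambda>n. poly (p n)) h sequentially"
    using p eq by (simp add: uniform_limit_iff)
  ultimately show ?thesis using fc_tendsto[OF _ x] LIMSEQ_unique by blast
qed

lemma fc_poly: "x \<in> K \<Longrightarrow> fc (poly p) x = opp p x"
proof -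
  assume x: "x \<in> K"
  have "uniform_limit J (\<lambda>n. poly p) (poly p) sequentially" by (rule uniform_limitI) simp
  from LIMSEQ_unique[OF tendsto_const fc_tendsto[OF this x]] show ?thesis by simp
qed

lemma fc_const: "x \<in> K \<Longrightarrow> fc (\<lambda>_. c) x = c *\<^sub>R x"
  using fc_poly[of x "[:c:]"] by (simp add: opp_const poly_pCons[abs_def])

lemma fc_id: "x \<in> K \<Longrightarrow> fc (\<lambda>t. t) x = T x"
  using fc_poly[of x "[:0, 1:]"] by (simp add: opp_linear poly_pCons[abs_def])

lemma fc_add:
  assumes "continuous_on J g" "continuous_on J h" "x \<in> K"
  shows "fc (\<lambda>t. g t + h t) x = fc g x + fc h x"
proof -
  obtain p where p: "uniform_limit J (\<lambda>n. poly (p n)) g sequentially"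
    using uniform_limit_polynomials[OF assms(1)] .
  obtain q where q: "uniform_limit J (\<lambda>n. poly (q n)) h sequentially"
    using uniform_limit_polynomials[OF assms(2)] .
  have "uniform_limit J (\<lambda>n. poly (p n + q n)) (\<lambda>t. g t + h t) sequentially"
    unfolding poly_add[abs_def] by (rule uniform_limit_add[OF p q])
  from fc_tendsto[OF this assms(3)]
  have "(\<lambda>n. opp (p n) x + opp (q n) x) \<longlonglongrightarrow> fc (\<lambda>t. g t + h t) x"
    by (simp add: opp_add assms(3))
  moreover have "(\<lambda>n. opp (p n) x + opp (q n) x) \<longlonglongrightarrow> fc g x + fc h x"
    by (intro tendsto_add fc_tendsto p q assms)
  ultimately show ?thesis using LIMSEQ_unique by blast
qed

lemma eq_by_ri:
  assumes "u \<in> K" "v \<in> K" "\<And>y. y \<in> K \<Longrightarrow> ri y u = ri y v"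
  shows "u = v"
proof -
  have "ri (u - v) (u - v) = 0"
    using assms(3)[OF diff_mem[OF assms(1,2)]] by (simp add: ri_diff_right[of "u - v"])
  then show ?thesis by (simp add: ri_same)
qed

text \<open>Proved weakly: moving \<open>p n\<close> to the other argument leaves
  \<open>ri (opp (p n) y) (opp (q n) x)\<close>, where each argument converges separately.\<close>

lemma fc_mult:
  assumes g: "continuous_on J g" and h: "continuous_on J h" and x: "x \<in> K"
  shows "fc (\<lambda>t. g t * h t) x = fc g (fc h x)"
proof (rule eq_by_ri)
  show "fc (\<lambda>t. g t * h t) x \<in> K" "fc g (fc h x) \<in> K"
    by (intro fc_mem continuous_intros g h x)+
  fix y assume y: "y \<in> K"
  obtain p where p: "uniform_limit J (\<lambda>n. poly (p n)) g sequentially"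
    using uniform_limit_polynomials[OF g] .
  obtain q where q: "uniform_limit J (\<lambda>n. poly (q n)) h sequentially"
    using uniform_limit_polynomials[OF h] .
  have "bounded (g ` J)" "bounded (h ` J)"
    by (intro compact_imp_bounded compact_continuous_image g h compact_Icc)+
  from uniform_lim_mult[OF p q this]
  have "uniform_limit J (\<lambda>n. poly (p n * q n)) (\<lambda>t. g t * h t) sequentially"
    by (simp add: poly_mult[abs_def])
  from tendsto_ri[OF tendsto_const fc_tendsto[OF this x]]
  have "(\<lambda>n. ri y (opp (p n) (opp (q n) x))) \<longlonglongrightarrow> ri y (fc (\<lambda>t. g t * h t) x)"
    using x by (simp add: opp_mult)
  then have "(\<lambda>n. ri (opp (p n) y) (opp (q n) x)) \<longlonglongrightarrow> ri y (fc (\<lambda>t. g t * h t) x)"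
    by (simp add: self_adjoint_ri[OF opp_self_adjoint y opp_mem[OF x]])
  moreover have "(\<lambda>n. ri (opp (p n) y) (opp (q n) x)) \<longlonglongrightarrow> ri (fc g y) (fc h x)"
    by (intro tendsto_ri fc_tendsto p q x y)
  ultimately have "ri y (fc (\<lambda>t. g t * h t) x) = ri (fc g y) (fc h x)"
    using LIMSEQ_unique by blast
  also have "\<dots> = ri y (fc g (fc h x))" by (rule fc_ri[OF g y fc_mem[OF h x]])
  finally show "ri y (fc (\<lambda>t. g t * h t) x) = ri y (fc g (fc h x))" .
qed

lemma fc_scale:
  assumes "continuous_on J g" "x \<in> K"
  shows "fc (\<lambda>t. c * g t) x = c *\<^sub>R fc g x"
  using fc_mult[OF continuous_on_const assms(1,2), of c] fc_mem[OF assms] by (simp add: fc_const)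

lemma fc_diff:
  assumes "continuous_on J g" "continuous_on J h" "x \<in> K"
  shows "fc (\<lambda>t. g t - h t) x = fc g x - fc h x"
  using fc_add[OF assms(1) continuous_on_mult_left[OF assms(2), of "-1"] assms(3)]
    fc_scale[OF assms(2,3), of "-1"] by simp

lemma fc_sum:
  assumes "\<And>i. i \<in> A \<Longrightarrow> continuous_on J (g i)" "x \<in> K"
  shows "fc (\<lambda>t. \<Sum>i\<in>A. g i t) x = (\<Sum>i\<in>A. fc (g i) x)"
  using assms(1)
proof (induction A rule: infinite_finite_induct)
  case (insert a A)
  then show ?case
    using fc_add[of "g a" "\<lambda>t. \<Sum>i\<in>A. g i t" x] assms(2) by (simp add: continuous_on_sum)
qed (simp_all add: fc_const assms(2))

lemma fc_nonneg:
  assumes g: "continuous_on J g" and pos: "\<And>t. t \<in> J \<Longrightarrow> 0 \<le> g t" and x: "x \<in> K"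
  shows "0 \<le> ri x (fc g x)"
proof (rule field_le_epsilon)
  fix e :: real assume e: "e > 0"
  \<comment> \<open>The approximating polynomials may dip below \<open>0\<close> by less than
    \<open>c\<close>; this \<open>c\<close> makes the dip cost at most \<open>e\<close> in the
    quadratic form.\<close>
  define c where "c = e / ((norm x)\<^sup>2 + 1)"
  have c: "c > 0" "c * (norm x)\<^sup>2 \<le> e"
    using e add_nonneg_pos[OF zero_le_power2[of "norm x"] zero_less_one]
    by (simp_all add: c_def divide_le_eq algebra_simps)
  obtain p where p: "uniform_limit J (\<lambda>n. poly (p n)) g sequentially"
    using uniform_limit_polynomials[OF g] .
  have "- e \<le> ri x (fc g x)"
  proof (rule tendsto_lowerbound)
    show "(\<lambda>n. ri x (opp (p n) x)) \<longlonglongrightarrow> ri x (fc g x)"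
      by (intro tendsto_ri fc_tendsto p x tendsto_const)
    show "\<forall>\<^sub>F n in sequentially. - e \<le> ri x (opp (p n) x)"
      using uniform_limitD[OF p c(1)]
    proof eventually_elim
      case (elim n)
      have "0 \<le> ri x (opp (p n + [:c:]) x)"
      proof (rule opp_nonneg[OF _ x])
        fix t assume "t \<in> rspec"
        then have "t \<in> J" using rspec_subset by blast
        then have "dist (poly (p n) t) (g t) < c" "0 \<le> g t" using elim pos by blast+
        then show "0 \<le> poly (p n + [:c:]) t" by (simp add: dist_real_def)
      qed
      then show ?case using x c by (simp add: opp_add opp_const ri_simps ri_same)
    qed
  qed simp
  then show "0 \<le> ri x (fc g x) + e" by simp
qed

lemma fc_mono:
  assumes "continuous_on J g" "continuous_on J h" "\<And>t. t \<in> J \<Longrightarrow> g t \<le> h t" "x \<in> K"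
  shows "ri x (fc g x) \<le> ri x (fc h x)"
  using fc_nonneg[of "\<lambda>t. h t - g t" x] assms
  by (simp add: continuous_on_diff fc_diff ri_diff_right)

lemma norm_fc_sq:
  assumes "continuous_on J g" "x \<in> K"
  shows "(norm (fc g x))\<^sup>2 = ri x (fc (\<lambda>t. (g t)\<^sup>2) x)"
  unfolding power2_eq_square[of "g _"]
  using assms fc_ri[OF assms fc_mem[OF assms]] by (simp add: fc_mult ri_same)

text \<open>Replaces the orthogonality of spectral projections: overlapping continuous cutoffs need
  only a pointwise bound on their sum of squares.\<close>

lemma sum_norm_fc_sq_le:
  assumes g: "\<And>i. i \<in> A \<Longrightarrow> continuous_on J (g i)"
    and le: "\<And>t. t \<in> J \<Longrightarrow> (\<Sum>i\<in>A. (g i t)\<^sup>2) \<le> c" and x: "x \<in> K"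
  shows "(\<Sum>i\<in>A. (norm (fc (g i) x))\<^sup>2) \<le> c * (norm x)\<^sup>2"
proof -
  have "(\<Sum>i\<in>A. (norm (fc (g i) x))\<^sup>2) = ri x (\<Sum>i\<in>A. fc (\<lambda>t. (g i t)\<^sup>2) x)"
    by (simp add: ri_sum_right norm_fc_sq g x cong: sum.cong)
  also have "\<dots> = ri x (fc (\<lambda>t. \<Sum>i\<in>A. (g i t)\<^sup>2) x)"
    by (subst fc_sum) (auto intro!: continuous_intros g x)
  also have "\<dots> \<le> ri x (fc (\<lambda>_. c) x)"
    by (intro fc_mono) (auto intro!: continuous_intros g x le)
  finally show ?thesis by (simp add: fc_const x ri_simps ri_same)
qed

end

section \<open>Tent functions and chords of a strictly convex function\<close>

text \<open>Its integer translates form a continuous partition of unity, used in place of indicator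
  functions of spectral intervals.\<close>

definition tent :: "real \<Rightarrow> real" where "tent u = max 0 (1 - \<bar>u\<bar>)"

lemma tent_nonneg: "0 \<le> tent u" and tent_le_one: "tent u \<le> 1"
  and tent_eq_0: "1 \<le> \<bar>u\<bar> \<Longrightarrow> tent u = 0"
  by (auto simp: tent_def)

lemma continuous_tent: "continuous_on S g \<Longrightarrow> continuous_on S (\<lambda>t. tent (g t))"
  unfolding tent_def by (intro continuous_intros)

text \<open>In the induction either the new tent misses \<open>u\<close>, or \<open>u\<close>
  exceeds \<open>n\<close> and only the last two tents survive. The second identity says that linear
  interpolation at the integers reproduces the identity function.\<close>

lemma tent_partition:
  assumes "0 \<le> u" "u \<le> real n"
  shows sum_tent: "(\<Sum>i\<le>n. tent (u - real i)) = 1"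
    and sum_mult_tent: "(\<Sum>i\<le>n. real i * tent (u - real i)) = u"
proof -
  have "(\<Sum>i\<le>n. tent (u - real i)) = 1 \<and> (\<Sum>i\<le>n. real i * tent (u - real i)) = u"
    using assms
  proof (induction n)
    case 0
    then show ?case by (simp add: tent_def)
  next
    case (Suc n)
    show ?case
    proof (cases "u \<le> real n")
      case True
      then have "tent (u - real (Suc n)) = 0" by (simp add: tent_eq_0)
      with Suc True show ?thesis by simp
    next
      case False
      have "tent (u - real i) = 0" if "i < n" for i
        using that False by (intro tent_eq_0) linarith
      then have "(\<Sum>i<n. tent (u - real i)) = 0" "(\<Sum>i<n. real i * tent (u - real i)) = 0"
        by (auto intro!: sum.neutral)
      then have "(\<Sum>i\<le>n. tent (u - real i)) = tent (u - n)"
        "(\<Sum>i\<le>n. real i * tent (u - real i)) = n * tent (u - n)"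
        by (simp_all flip: lessThan_Suc_atMost)
      moreover have "tent (u - n) = 1 - (u - n)" "tent (u - real (Suc n)) = u - n"
        using False Suc.prems by (auto simp: tent_def)
      ultimately show ?thesis by (simp only: sum.atMost_Suc) (simp add: algebra_simps)
    qed
  qed
  then show "(\<Sum>i\<le>n. tent (u - real i)) = 1" "(\<Sum>i\<le>n. real i * tent (u - real i)) = u"
    by auto
qed

lemma sum_tent_sq_le:
  assumes "0 \<le> u" "u \<le> real n"
  shows "(\<Sum>i\<le>n. (tent (u - real i))\<^sup>2) \<le> 1"
proof -
  have "(tent v)\<^sup>2 \<le> tent v" for v
    using mult_left_mono[OF tent_le_one tent_nonneg, of v v] by (simp add: power2_eq_square)
  then have "(\<Sum>i\<le>n. (tent (u - real i))\<^sup>2) \<le> (\<Sum>i\<le>n. tent (u - real i))" by (intro sum_mono)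
  with sum_tent[OF assms] show ?thesis by simp
qed

section \<open>Position of a strictly convex function relative to its chords\<close>

lemma strictly_convex_onD:
  "strictly_convex_on I f \<Longrightarrow> x \<in> I \<Longrightarrow> y \<in> I \<Longrightarrow> x \<noteq> y \<Longrightarrow> 0 < t \<Longrightarrow> t < 1
    \<Longrightarrow> f ((1 - t) * x + t * y) < (1 - t) * f x + t * f y"
  by (simp add: strictly_convex_on_def)

lemma strictly_convex_on_subset: "strictly_convex_on I f \<Longrightarrow> S \<subseteq> I \<Longrightarrow> strictly_convex_on S f"
  unfolding strictly_convex_on_def by blast

text \<open>Convexity cleared of denominators. An affine function satisfies the relation with
  equality, so one may be subtracted from \<open>f\<close>; later it is a chord, which makes two of
  the three values vanish or one of them known.\<close>

lemma strictly_convex_imp_three_points: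
  assumes f: "strictly_convex_on {lo..hi} f" and x: "lo \<le> x" "x < y" "y < z" "z \<le> hi"
  shows "(z - x) * (f y - (c + d * y)) < (z - y) * (f x - (c + d * x)) + (y - x) * (f z - (c + d * z))"
proof -
  define t where "t = (y - x) / (z - x)"
  have t: "0 < t" "t < 1" using x by (auto simp: t_def)
  have tz: "t * (z - x) = y - x" using x by (simp add: t_def)
  then have y: "(1 - t) * x + t * z = y" by (simp add: algebra_simps)
  have "f y < (1 - t) * f x + t * f z"
    using strictly_convex_onD[OF f _ _ _ t, of x z] x by (simp add: y)
  then have "(z - x) * f y < (z - x) * ((1 - t) * f x + t * f z)"
    using x by (intro mult_strict_left_mono) auto
  also have "\<dots> = ((z - x) - t * (z - x)) * f x + t * (z - x) * f z"
    by (simp add: algebra_simps)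
  also have "\<dots> = (z - y) * f x + (y - x) * f z"
    by (simp add: tz)
  finally show ?thesis by (simp add: algebra_simps)
qed

text \<open>For \<open>s\<close> beyond an end of the chord, that end is the middle one of three
  points at which \<open>f\<close> minus the chord is \<open>0\<close>, \<open>0\<close> and the
  value in question.\<close>

lemma chord_outside:
  assumes f: "strictly_convex_on {lo..hi} f" and ab: "lo \<le> a" "a < b" "b \<le> hi"
    and chord: "c + d * a = f a" "c + d * b = f b" and s: "lo \<le> s" "s \<le> hi" "s \<le> a \<or> b \<le> s"
  shows "0 \<le> f s - (c + d * s)"
proof -
  consider "s = a" | "s = b" | "s < a" | "b < s" using s by linarith
  then show ?thesis
  proof cases
    case 3
    with strictly_convex_imp_three_points[OF f s(1) 3 ab(2,3), of c d] ab chord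
    have "0 < (b - a) * (f s - (c + d * s))" by simp
    then show ?thesis using ab by (simp add: zero_less_mult_iff)
  next
    case 4
    with strictly_convex_imp_three_points[OF f ab(1,2) 4 s(2), of c d] ab chord
    have "0 < (b - a) * (f s - (c + d * s))" by simp
    then show ?thesis using ab by (simp add: zero_less_mult_iff)
  qed (use chord in auto)
qed

lemma chord_inside:
  assumes f: "strictly_convex_on {lo..hi} f" and ab: "lo \<le> a" "a < b" "b \<le> hi"
    and chord: "c + d * a = f a" "c + d * b = f b" and s: "a \<le> s" "s \<le> b"
  shows "f s - (c + d * s) \<le> 0"
proof -
  consider "s = a" | "s = b" | "a < s" "s < b" using s by linarith
  then show ?thesis
  proof cases
    case 3
    with strictly_convex_imp_three_points[OF f ab(1) 3 ab(3), of c d] ab chord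
    have "(b - a) * (f s - (c + d * s)) < 0" by simp
    then show ?thesis using ab by (simp add: mult_less_0_iff)
  qed (use chord in auto)
qed

text \<open>Affine functions have zero second difference and the chord interpolates at
  \<open>a\<close> and \<open>a + h\<close>, so \<open>e\<close> is exactly the value of
  \<open>f\<close> minus the chord at \<open>a - h\<close>. Convexity then bounds the remaining
  values by \<open>e\<close>.\<close>

lemma chord_inner:
  assumes f: "strictly_convex_on {lo..hi} f" and h: "0 < h" "lo \<le> a - h" "a + h \<le> hi"
    and chord: "c + d * a = f a" "c + d * (a + h) = f (a + h)"
    and e: "e = f (a + h) - 2 * f a + f (a - h)"
  shows "0 \<le> e" "lo \<le> s \<Longrightarrow> s \<le> hi \<Longrightarrow> - e \<le> f s - (c + d * s)"
    "\<bar>s - a\<bar> \<le> h \<Longrightarrow> f s - (c + d * s) \<le> e"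
proof -
  let ?g = "\<lambda>s. f s - (c + d * s)"
  have a: "lo \<le> a" "a < a + h" using h by auto
  have e': "e = ?g (a - h)" using chord e by (simp add: algebra_simps)
  show e0: "0 \<le> e"
    unfolding e' by (rule chord_outside[OF f a h(3) chord]) (use h in auto)
  show "- e \<le> ?g s" if s: "lo \<le> s" "s \<le> hi"
  proof (cases "a < s \<and> s < a + h")
    case True
    then have "(s - (a - h)) * 0 \<le> (s - a) * e + h * ?g s"
      using strictly_convex_imp_three_points[OF f h(2), of a s c d] h s chord by (simp add: e')
    moreover have "(s - a) * e \<le> h * e" using True e0 by (intro mult_right_mono) auto
    ultimately have "0 \<le> h * (e + ?g s)" by (simp add: algebra_simps)
    then show ?thesis using h(1) by (simp add: zero_le_mult_iff)
  next
    case False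
    then show ?thesis using chord_outside[OF f a h(3) chord s] e0 by force
  qed
  show "?g s \<le> e" if s: "\<bar>s - a\<bar> \<le> h"
  proof -
    consider "s = a - h" | "s = a" | "a - h < s" "s < a" | "a < s" using s by linarith
    then show ?thesis
    proof cases
      case 3
      then have "h * ?g s \<le> (a - s) * e"
        using strictly_convex_imp_three_points[OF f h(2) 3, of c d] h chord by (simp add: e')
      also have "\<dots> \<le> h * e" using 3 e0 by (intro mult_right_mono) auto
      finally show ?thesis using h(1) by simp
    next
      case 4
      then show ?thesis using chord_inside[OF f a h(3) chord, of s] s e0 by auto
    qed (use e' e0 chord in auto)
  qed
qed

text \<open>For the cells at the two ends of \<open>[lo, hi]\<close>, where a centred second
  difference would leave the interval; the oscillation of \<open>f\<close> on the cell takes its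
  place.\<close>

lemma chord_edge:
  assumes f: "strictly_convex_on {lo..hi} f" and ab: "lo \<le> a" "a < b" "b \<le> hi"
    and chord: "c + d * a = f a" "c + d * b = f b"
    and osc: "\<And>x y. x \<in> {a..b} \<Longrightarrow> y \<in> {a..b} \<Longrightarrow> \<bar>f x - f y\<bar> \<le> e"
  shows "0 \<le> e" "lo \<le> s \<Longrightarrow> s \<le> hi \<Longrightarrow> - e \<le> f s - (c + d * s)"
    "s \<in> {a..b} \<Longrightarrow> f s - (c + d * s) \<le> e"
proof -
  show e0: "0 \<le> e" using osc[of a a] ab by simp
  show "- e \<le> f s - (c + d * s)" if s: "lo \<le> s" "s \<le> hi"
  proof (cases "s \<le> a \<or> b \<le> s")
    case True
    then show ?thesis using chord_outside[OF f ab chord s] e0 by force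
  next
    case False
    have "f a \<le> f s + e" "f b \<le> f s + e"
      using osc[of a s] osc[of b s] False by auto
    then have "(b - s) * f a + (s - a) * f b \<le> (b - s) * (f s + e) + (s - a) * (f s + e)"
      using False by (intro add_mono mult_left_mono) auto
    also have "(b - s) * f a + (s - a) * f b = (b - a) * (c + d * s)"
      by (simp add: chord[symmetric] algebra_simps)
    finally have "0 \<le> (b - a) * (f s + e - (c + d * s))" by (simp add: algebra_simps)
    then show ?thesis using ab by (simp add: zero_le_mult_iff)
  qed
  show "f s - (c + d * s) \<le> e" if "s \<in> {a..b}"
    using chord_inside[OF f ab chord, of s] that e0 by auto
qed

text \<open>To the right of \<open>b\<close>, \<open>f\<close> minus the chord is nonnegative and
  nondecreasing. Subtracting the chord does not change the left-hand side, which is thus a lower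
  bound independent of the chord.\<close>

lemma gap_right:
  assumes f: "strictly_convex_on {lo..hi} f" and ab: "lo \<le> a" "a < b" "b \<le> u" "u \<le> v" "v \<le> s" "s \<le> hi"
    and chord: "c + d * a = f a" "c + d * b = f b"
  shows "f u + f v - 2 * f ((u + v) / 2) \<le> f s - (c + d * s)"
proof -
  let ?g = "\<lambda>s. f s - (c + d * s)"
  have mono: "?g x \<le> ?g y" if xy: "b \<le> x" "x \<le> y" "y \<le> hi" for x y
  proof (cases "x = y")
    case False
    have g: "0 \<le> ?g y"
      by (rule chord_outside[OF f ab(1,2) _ chord]) (use xy ab in auto)
    have "(y - a) * ?g x \<le> (x - a) * ?g y"
      using strictly_convex_imp_three_points[OF f ab(1), of x y c d] False xy ab chord by simp
    also have "\<dots> \<le> (y - a) * ?g y" using xy g by (intro mult_right_mono) auto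
    finally show ?thesis using xy ab by simp
  qed simp
  have aux: "p + q - 2 * l \<le> t" if "p \<le> l" "q \<le> t" "0 \<le> l" for p q l t :: real
    using that by linarith
  have le: "?g u \<le> ?g ((u + v) / 2)" by (rule mono) (use ab in auto)
  have le': "?g v \<le> ?g s" by (rule mono) (use ab in auto)
  have pos: "0 \<le> ?g ((u + v) / 2)"
    by (rule chord_outside[OF f ab(1,2) _ chord]) (use ab in auto)
  have "f u + f v - 2 * f ((u + v) / 2) = ?g u + ?g v - 2 * ?g ((u + v) / 2)"
    by (simp add: field_simps)
  with aux[OF le le' pos] show ?thesis by (simp only:)
qed

lemma strictly_convex_reflect:
  assumes "strictly_convex_on {lo..hi} f"
  shows "strictly_convex_on {- hi..- lo} (\<lambda>t. f (- t))"
  unfolding strictly_convex_on_def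
proof (intro ballI allI impI)
  fix x y t :: real assume "x \<in> {- hi..- lo}" "y \<in> {- hi..- lo}" "x \<noteq> y" "0 < t" "t < 1"
  then have "f ((1 - t) * (- x) + t * (- y)) < (1 - t) * f (- x) + t * f (- y)"
    by (intro strictly_convex_onD[OF assms]) auto
  moreover have "(1 - t) * (- x) + t * (- y) = - ((1 - t) * x + t * y)"
    by (simp add: algebra_simps)
  ultimately show "f (- ((1 - t) * x + t * y)) < (1 - t) * f (- x) + t * f (- y)" by simp
qed

lemma midpoint_gap_pos:
  assumes "strictly_convex_on {lo..hi} f" "lo \<le> u" "u < v" "v \<le> hi"
  shows "0 < f u + f v - 2 * f ((u + v) / 2)"
proof -
  have "f ((1 - 1 / 2) * u + 1 / 2 * v) < (1 - 1 / 2) * f u + 1 / 2 * f v"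
    by (rule strictly_convex_onD[OF assms(1)]) (use assms in auto)
  then show ?thesis by (simp add: field_simps)
qed

text \<open>Chord ends lie within \<open>3 / 2 * r\<close> of \<open>m\<close> and \<open>s\<close>
  at least \<open>2 * r\<close> away, so the fixed interval between these two distances fits between
  them and \<open>gap_right\<close> applies to it.\<close>

lemma far_gap:
  assumes f: "strictly_convex_on {lo..hi} f" and r: "0 < r"
  obtains g where "0 < g"
    "\<And>a b c d s. \<lbrakk>lo \<le> a; a < b; b \<le> hi; c + d * a = f a; c + d * b = f b;
      \<bar>a - m\<bar> \<le> 3 / 2 * r; \<bar>b - m\<bar> \<le> 3 / 2 * r; lo \<le> s; s \<le> hi; 2 * r \<le> \<bar>s - m\<bar>\<rbrakk>
      \<Longrightarrow> g \<le> f s - (c + d * s)"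
proof -
  \<comment> \<open>If the test interval leaves \<open>[lo, hi]\<close>, no admissible chord and
    point \<open>s\<close> exist on that side; the default \<open>1\<close> then only keeps the
    minimum positive.\<close>
  define gap where "gap u v = (if lo \<le> u \<and> v \<le> hi then f u + f v - 2 * f ((u + v) / 2) else 1)" for u v
  have gap_pos: "0 < gap u v" if "u < v" for u v
    using midpoint_gap_pos[OF f _ that] by (auto simp: gap_def)
  define g1 g2 where "g1 = gap (m + 3 / 2 * r) (m + 2 * r)" and "g2 = gap (m - 2 * r) (m - 3 / 2 * r)"
  show ?thesis
  proof (rule that)
    show "0 < min g1 g2" using r by (auto simp: g1_def g2_def intro!: gap_pos)
    fix a b c d s
    assume ab: "lo \<le> a" "a < b" "b \<le> hi" and chord: "c + d * a = f a" "c + d * b = f b"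
      and near: "\<bar>a - m\<bar> \<le> 3 / 2 * r" "\<bar>b - m\<bar> \<le> 3 / 2 * r"
      and s: "lo \<le> s" "s \<le> hi" "2 * r \<le> \<bar>s - m\<bar>"
    show "min g1 g2 \<le> f s - (c + d * s)"
    proof (cases "s \<ge> m")
      case True
      have b: "b \<le> m + 3 / 2 * r" "m + 3 / 2 * r \<le> m + 2 * r" "m + 2 * r \<le> s"
        using near s(3) True r by (simp_all only: abs_le_iff abs_of_nonneg) (linarith | simp)+
      have "g1 \<le> f s - (c + d * s)"
        using gap_right[OF f ab(1,2) b s(2) chord] b ab s unfolding g1_def gap_def by auto
      then show ?thesis by simp
    next
      case False
      have b: "- a \<le> - (m - 3 / 2 * r)" "- (m - 3 / 2 * r) \<le> - (m - 2 * r)" "- (m - 2 * r) \<le> - s"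
        using near s(3) False r by (simp_all only: abs_le_iff abs_of_neg not_le) (linarith | simp)+
      \<comment> \<open>The left side is the right side for the reflected function.\<close>
      have "(\<lambda>t. f (- t)) (- (m - 3 / 2 * r)) + (\<lambda>t. f (- t)) (- (m - 2 * r))
          - 2 * (\<lambda>t. f (- t)) ((- (m - 3 / 2 * r) + - (m - 2 * r)) / 2)
          \<le> (\<lambda>t. f (- t)) (- s) - (c + (- d) * (- s))"
        by (rule gap_right[where a = "- b", OF strictly_convex_reflect[OF f] _ _ b]) (use ab s chord in auto)
      moreover have "- ((- (m - 3 / 2 * r) + - (m - 2 * r)) / 2) = (m - 2 * r + (m - 3 / 2 * r)) / 2"
        by (simp add: field_simps)
      ultimately have "f (m - 2 * r) + f (m - 3 / 2 * r) - 2 * f ((m - 2 * r + (m - 3 / 2 * r)) / 2)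
          \<le> f s - (c + d * s)"
        by (simp only: minus_minus mult_minus_left mult_minus_right)
      then have "g2 \<le> f s - (c + d * s)"
        using b ab s unfolding g2_def gap_def by auto
      then show ?thesis by simp
    qed
  qed
qed

lemma sum_second_difference:
  "(\<Sum>i<k. F (Suc (Suc i)) - 2 * F (Suc i) + F i) = (F (Suc k) - F k) - (F 1 - F 0 :: real)"
  by (induction k) auto

lemma chord_at_node:
  fixes n :: nat
  assumes f: "strictly_convex_on {lo..hi} f" and n: "0 < n" and h: "h = (hi - lo) / n" "0 < h"
    and osc: "\<And>x y. x \<in> {lo..hi} \<Longrightarrow> y \<in> {lo..hi} \<Longrightarrow> \<bar>x - y\<bar> \<le> h \<Longrightarrow> \<bar>f x - f y\<bar> \<le> w"
    and N: "\<And>i. N i = lo + real i * h"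
    and e: "\<And>i. e i = (if i = 0 \<or> i = n then w else f (N (Suc i)) - 2 * f (N i) + f (N (i - 1)))"
    and i: "i \<le> n"
  shows "\<exists>a b c d. lo \<le> a \<and> a < b \<and> b \<le> hi \<and> c + d * a = f a \<and> c + d * b = f b
    \<and> \<bar>a - N i\<bar> \<le> h \<and> \<bar>b - N i\<bar> \<le> h \<and> 0 \<le> e i
    \<and> (\<forall>s\<in>{lo..hi}. - e i \<le> f s - (c + d * s))
    \<and> (\<forall>s\<in>{lo..hi}. \<bar>s - N i\<bar> \<le> h \<longrightarrow> f s - (c + d * s) \<le> e i)"
proof -
  have nh: "real n * h = hi - lo" using n h by simp
  have Nle: "N j \<le> hi" if "j \<le> n" for j
    using mult_right_mono[of "real j" "real n" h] that h nh by (simp add: N)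
  have Nge: "lo \<le> N j" for j
    using mult_nonneg_nonneg[OF of_nat_0_le_iff less_imp_le[OF h(2)], of j] by (simp add: N)
  \<comment> \<open>Each node uses the chord to its right, except the last one, whose right
    neighbour would lie outside \<open>[lo, hi]\<close>.\<close>
  define j where "j = (if i = n then n - 1 else i)"
  have j: "j < n" using n i by (auto simp: j_def)
  define a b where "a = N j" and "b = N (Suc j)"
  have ab: "lo \<le> a" "a < b" "b \<le> hi" "b = a + h"
    using Nle[of "Suc j"] Nge[of j] j h(2) by (auto simp: a_def b_def N algebra_simps)
  define d where "d = (f b - f a) / (b - a)"
  define c where "c = f a - d * a"
  have chord: "c + d * a = f a" "c + d * b = f b"
  proof -
    show "c + d * a = f a" by (simp add: c_def)
    have "d * (b - a) = f b - f a" using ab by (simp add: d_def)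
    then show "c + d * b = f b" by (simp add: c_def algebra_simps)
  qed
  have near: "\<bar>a - N i\<bar> \<le> h" "\<bar>b - N i\<bar> \<le> h"
    using n h(2) i by (auto simp: a_def b_def N j_def algebra_simps of_nat_diff)
  have "0 \<le> e i \<and> (\<forall>s\<in>{lo..hi}. - e i \<le> f s - (c + d * s))
      \<and> (\<forall>s\<in>{lo..hi}. \<bar>s - N i\<bar> \<le> h \<longrightarrow> f s - (c + d * s) \<le> e i)"
  proof (cases "i = 0 \<or> i = n")
    case True
    then have ei: "e i = w" by (simp add: e)
    have osc': "\<bar>f x - f y\<bar> \<le> w" if "x \<in> {a..b}" "y \<in> {a..b}" for x y
      using that ab by (intro osc) auto
    have "s \<in> {a..b}" if "s \<in> {lo..hi}" "\<bar>s - N i\<bar> \<le> h" for s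
    proof (cases "i = n")
      case True
      then have "N i = hi" "b = hi" using nh n by (simp_all add: N b_def j_def)
      then show ?thesis using that ab by auto
    next
      case False
      then have "i = 0" using \<open>i = 0 \<or> i = n\<close> by simp
      then have "N i = lo" "a = lo" using False by (simp_all add: N a_def j_def)
      then show ?thesis using that ab by auto
    qed
    then show ?thesis
      using chord_edge[OF f ab(1-3) chord osc'] unfolding ei by auto
  next
    case False
    then have i0: "0 < i" "i < n" using i by auto
    have ai: "a = N i" using i0 by (simp add: a_def j_def)
    have "N (i - 1) = a - h" using i0 by (simp add: ai N of_nat_diff algebra_simps)
    moreover have "N (Suc i) = a + h" by (simp add: ai N algebra_simps)
    ultimately have ei: "e i = f (a + h) - 2 * f a + f (a - h)" and "lo \<le> a - h"
      using i0 Nge[of "i - 1"] by (auto simp: e ai)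
    from chord_inner[OF f h(2) this(2) ab(3)[unfolded ab(4)] chord[unfolded ab(4)] ei] show ?thesis
      by (auto simp: ai)
  qed
  then show ?thesis using ab(1-3) chord near by blast
qed

text \<open>\<open>C\<close> can be fixed before \<open>\<epsilon>\<close>: it depends on a bound
  for \<open>w\<close> and on the gap from \<open>far_gap\<close>, not on the mesh. Refining the
  mesh makes the total error small because second differences telescope.\<close>

lemma chord_family:
  fixes f w :: "real \<Rightarrow> real"
  assumes lohi: "lo < hi" and f: "strictly_convex_on {lo..hi} f" "continuous_on {lo..hi} f"
    and w: "continuous_on {lo..hi} w" "\<And>s. s \<in> {lo..hi} \<Longrightarrow> \<bar>s - m\<bar> \<le> 2 * r \<Longrightarrow> w s = 0"
    and r: "0 < r"
  shows "\<exists>C\<ge>0. \<forall>\<epsilon>>0. \<exists>n h c d e. 0 < n \<and> h = (hi - lo) / real n \<and> 0 < h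
      \<and> (\<forall>i\<le>n. 0 \<le> e i) \<and> (\<Sum>i\<le>n. e i) \<le> \<epsilon>
      \<and> (\<forall>i\<le>n. \<forall>s\<in>{lo..hi}. \<bar>s - (lo + real i * h)\<bar> \<le> h \<longrightarrow> f s - (c i + d i * s) \<le> e i)
      \<and> (\<forall>i\<le>n. \<forall>s\<in>{lo..hi}. \<bar>lo + real i * h - m\<bar> < r + h \<longrightarrow>
            (w s)\<^sup>2 \<le> C * (f s - (c i + d i * s) + e i))"
proof -
  obtain g where g: "0 < g" and gap: "\<And>a b c d s. \<lbrakk>lo \<le> a; a < b; b \<le> hi; c + d * a = f a; c + d * b = f b;
      \<bar>a - m\<bar> \<le> 3 / 2 * r; \<bar>b - m\<bar> \<le> 3 / 2 * r; lo \<le> s; s \<le> hi; 2 * r \<le> \<bar>s - m\<bar>\<rbrakk>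
      \<Longrightarrow> g \<le> f s - (c + d * s)"
    using far_gap[OF f(1) r] by metis
  have "bounded (w ` {lo..hi})"
    by (intro compact_imp_bounded compact_continuous_image w compact_Icc)
  then obtain B where "\<forall>y\<in>w ` {lo..hi}. norm y \<le> B" unfolding bounded_iff by blast
  then have B: "\<bar>w s\<bar> \<le> B" if "s \<in> {lo..hi}" for s using that by auto
  have B2: "(w s)\<^sup>2 \<le> B\<^sup>2" if "s \<in> {lo..hi}" for s
    using B[OF that] by (intro abs_le_square_iff[THEN iffD1]) linarith
  define C where "C = B\<^sup>2 / g"
  have C: "0 \<le> C" "C * g = B\<^sup>2" using g by (auto simp: C_def)
  show ?thesis
  proof (intro exI[of _ C] conjI C(1) allI impI)
    fix \<epsilon> :: real assume eps: "0 < \<epsilon>"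
    have "uniformly_continuous_on {lo..hi} f"
      by (rule compact_uniformly_continuous[OF f(2) compact_Icc])
    then obtain \<eta> where eta: "0 < \<eta>" "\<And>x y. x \<in> {lo..hi} \<Longrightarrow> y \<in> {lo..hi} \<Longrightarrow> \<bar>x - y\<bar> < \<eta> \<Longrightarrow> \<bar>f x - f y\<bar> < \<epsilon> / 4"
      using eps unfolding uniformly_continuous_on_def dist_real_def by (metis divide_pos_pos zero_less_numeral)
    \<comment> \<open>A node within \<open>r + h\<close> of \<open>m\<close> has chord ends within
      \<open>r + 2 * h\<close>, and \<open>h < r / 4\<close> keeps these within
      \<open>3 / 2 * r\<close>.\<close>
    define z where "z = min \<eta> (r / 4)"
    have z: "0 < z" using eta(1) r by (simp add: z_def)
    obtain k where k: "(hi - lo) / z < real k" using reals_Archimedean2 by blast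
    define n where "n = Suc k"
    define h where "h = (hi - lo) / real n"
    have h: "0 < h" using lohi by (simp add: h_def n_def)
    have "hi - lo < real n * z"
      using k z by (simp add: n_def pos_divide_less_eq algebra_simps)
    then have "h < z" by (simp add: h_def n_def pos_divide_less_eq mult.commute)
    then have h': "h < \<eta>" "h < r / 4" by (simp_all add: z_def)
    have osc: "\<bar>f x - f y\<bar> \<le> \<epsilon> / 4" if "x \<in> {lo..hi}" "y \<in> {lo..hi}" "\<bar>x - y\<bar> \<le> h" for x y
      using eta(2)[OF that(1,2)] that(3) h' by auto
    define N where "N i = lo + real i * h" for i
    \<comment> \<open>The two end cells use up half of \<open>\<epsilon>\<close>; the telescoped sum
      leaves two first differences of \<open>f\<close>, each at most
      \<open>\<epsilon> / 4\<close>.\<close>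
    define e where "e i = (if i = 0 \<or> i = n then \<epsilon> / 4 else f (N (Suc i)) - 2 * f (N i) + f (N (i - 1)))" for i
    have "\<forall>i\<in>{..n}. \<exists>a b c d. lo \<le> a \<and> a < b \<and> b \<le> hi \<and> c + d * a = f a \<and> c + d * b = f b
      \<and> \<bar>a - N i\<bar> \<le> h \<and> \<bar>b - N i\<bar> \<le> h \<and> 0 \<le> e i
      \<and> (\<forall>s\<in>{lo..hi}. - e i \<le> f s - (c + d * s))
      \<and> (\<forall>s\<in>{lo..hi}. \<bar>s - N i\<bar> \<le> h \<longrightarrow> f s - (c + d * s) \<le> e i)"
      by (intro ballI chord_at_node[OF f(1) _ h_def h osc N_def e_def]) (auto simp: n_def)
    then obtain a b c d where node0: "\<forall>i\<in>{..n}. lo \<le> a i \<and> a i < b i \<and> b i \<le> hi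
      \<and> c i + d i * a i = f (a i) \<and> c i + d i * b i = f (b i)
      \<and> \<bar>a i - N i\<bar> \<le> h \<and> \<bar>b i - N i\<bar> \<le> h \<and> 0 \<le> e i
      \<and> (\<forall>s\<in>{lo..hi}. - e i \<le> f s - (c i + d i * s))
      \<and> (\<forall>s\<in>{lo..hi}. \<bar>s - N i\<bar> \<le> h \<longrightarrow> f s - (c i + d i * s) \<le> e i)"
      unfolding bchoice_iff by (elim exE that)
    note node = bspec[OF node0, unfolded atMost_iff]
    have "(\<Sum>i\<le>n. e i) = e 0 + ((\<Sum>i<k. e (Suc i)) + e n)"
      unfolding n_def by (subst sum.atMost_Suc_shift) (simp flip: lessThan_Suc_atMost)
    also have "(\<Sum>i<k. e (Suc i)) = (\<Sum>i<k. f (N (Suc (Suc i))) - 2 * f (N (Suc i)) + f (N i))"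
      by (intro sum.cong) (auto simp: e_def n_def)
    also have "\<dots> = (f (N n) - f (N k)) - (f (N 1) - f (N 0))"
      by (simp only: sum_second_difference[of "\<lambda>i. f (N i)"] n_def)
    finally have sum_e: "(\<Sum>i\<le>n. e i) = \<epsilon> / 2 + ((f (N n) - f (N k)) - (f (N 1) - f (N 0)))"
      by (simp add: e_def)
    have NJ: "N i \<in> {lo..hi}" if "i \<le> n" for i
    proof -
      have "0 \<le> real i * h" "real i * h \<le> real n * h" using that h by (simp_all add: mult_right_mono)
      moreover have "real n * h = hi - lo" by (simp add: h_def n_def)
      ultimately show ?thesis by (simp add: N_def)
    qed
    have "\<bar>f (N n) - f (N k)\<bar> \<le> \<epsilon> / 4"
      by (rule osc[OF NJ NJ]) (use h in \<open>auto simp: n_def N_def algebra_simps\<close>)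
    moreover have "\<bar>f (N 1) - f (N 0)\<bar> \<le> \<epsilon> / 4"
      by (rule osc[OF NJ NJ]) (use h in \<open>auto simp: n_def N_def algebra_simps\<close>)
    ultimately have sum_le: "(\<Sum>i\<le>n. e i) \<le> \<epsilon>" unfolding sum_e by linarith
    have e_nonneg: "\<forall>i\<le>n. 0 \<le> e i" using node by blast
    have near: "\<forall>i\<le>n. \<forall>s\<in>{lo..hi}. \<bar>s - (lo + real i * h)\<bar> \<le> h \<longrightarrow> f s - (c i + d i * s) \<le> e i"
      using node unfolding N_def by blast
    have dom: "\<forall>i\<le>n. \<forall>s\<in>{lo..hi}. \<bar>lo + real i * h - m\<bar> < r + h \<longrightarrow>
            (w s)\<^sup>2 \<le> C * (f s - (c i + d i * s) + e i)"
    proof (intro allI impI ballI)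
      fix i s assume i: "i \<le> n" and s: "s \<in> {lo..hi}" and near: "\<bar>lo + real i * h - m\<bar> < r + h"
      from node[OF i] have ab: "lo \<le> a i" "a i < b i" "b i \<le> hi" "c i + d i * a i = f (a i)"
        "c i + d i * b i = f (b i)" "\<bar>a i - N i\<bar> \<le> h" "\<bar>b i - N i\<bar> \<le> h"
        by blast+
      from node[OF i] s have e: "0 \<le> e i" "- e i \<le> f s - (c i + d i * s)" by blast+
      show "(w s)\<^sup>2 \<le> C * (f s - (c i + d i * s) + e i)"
      \<comment> \<open>Near \<open>m\<close> the left-hand side vanishes and the right-hand side is
        nonnegative; away from \<open>m\<close> the gap times \<open>C\<close> already exceeds the
        supremum bound for \<open>w\<^sup>2\<close>.\<close>
      proof (cases "\<bar>s - m\<bar> \<le> 2 * r")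
        case True
        then have "w s = 0" using w(2) s by blast
        moreover have "0 \<le> f s - (c i + d i * s) + e i" using e by linarith
        ultimately show ?thesis using C by simp
      next
        case False
        have ms: "\<bar>a i - m\<bar> \<le> 3 / 2 * r" "\<bar>b i - m\<bar> \<le> 3 / 2 * r"
          using ab(6,7) near h' unfolding N_def by linarith+
        have "g \<le> f s - (c i + d i * s)"
          by (rule gap[OF ab(1-5) ms]) (use s False in auto)
        then have "C * g \<le> C * (f s - (c i + d i * s) + e i)"
          using e C by (intro mult_left_mono) auto
        then show ?thesis using B2[OF s] C by simp
      qed
    qed
    have "0 < n" by (simp add: n_def)
    show "\<exists>n h c d e. 0 < n \<and> h = (hi - lo) / real n \<and> 0 < h
      \<and> (\<forall>i\<le>n. 0 \<le> e i) \<and> (\<Sum>i\<le>n. e i) \<le> \<epsilon>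
      \<and> (\<forall>i\<le>n. \<forall>s\<in>{lo..hi}. \<bar>s - (lo + real i * h)\<bar> \<le> h \<longrightarrow> f s - (c i + d i * s) \<le> e i)
      \<and> (\<forall>i\<le>n. \<forall>s\<in>{lo..hi}. \<bar>lo + real i * h - m\<bar> < r + h \<longrightarrow>
            (w s)\<^sup>2 \<le> C * (f s - (c i + d i * s) + e i))"
      by (intro exI[of _ n] exI[of _ h] exI[of _ c] exI[of _ d] exI[of _ e] conjI)
        (fact \<open>0 < n\<close> h_def h e_nonneg sum_le near dom)+
  qed
qed

section \<open>The equality case\<close>

lemma nonpos_if_le_all_multiples:
  fixes p A :: real
  assumes "\<And>\<epsilon>. 0 < \<epsilon> \<Longrightarrow> p \<le> A * \<epsilon>" "0 \<le> A"
  shows "p \<le> 0"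
proof (rule field_le_epsilon)
  fix e :: real assume e: "0 < e"
  then have "p \<le> A * (e / (A + 1))"
    using assms(2) by (intro assms(1)) (simp add: add_nonneg_pos)
  also have "\<dots> \<le> e" using e assms(2) by (simp add: field_simps)
  finally show "p \<le> 0 + e" by simp
qed

lemma (in sa_operator_interval) fc_affine_shift:
  assumes f: "continuous_on J f" and x: "x \<in> K"
  shows "fc (\<lambda>s. f s - (c + d * s) + e) x = fc f x - (c *\<^sub>R x + d *\<^sub>R T x) + e *\<^sub>R x"
proof -
  have "fc (\<lambda>s. f s - (c + d * s) + e) x = fc (\<lambda>s. f s - (c + d * s)) x + fc (\<lambda>_. e) x"
    by (intro fc_add continuous_intros f x)
  also have "fc (\<lambda>s. f s - (c + d * s)) x = fc f x - fc (\<lambda>s. c + d * s) x"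
    by (intro fc_diff continuous_intros f x)
  also have "fc (\<lambda>s. c + d * s) x = fc (\<lambda>_. c) x + fc (\<lambda>s. d * s) x"
    by (intro fc_add continuous_intros x)
  also have "fc (\<lambda>s. d * s) x = d *\<^sub>R T x"
    by (subst fc_scale) (auto intro!: continuous_intros simp: x fc_id)
  finally show ?thesis by (simp add: fc_const x)
qed

text \<open>The identity on \<open>[-2, 2]\<close>, continuously cut down to \<open>0\<close> at
  distance \<open>3\<close>: a localised version of \<open>s - t\<close> with boundedly overlapping
  translates.\<close>

definition cutoff :: "real \<Rightarrow> real" where
  "cutoff v = v * max 0 (min 1 (3 - \<bar>v\<bar>))"

lemma cutoff_eq: "\<bar>v\<bar> \<le> 2 \<Longrightarrow> cutoff v = v"
  by (simp add: cutoff_def)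

lemma continuous_cutoff: "continuous_on S g \<Longrightarrow> continuous_on S (\<lambda>t. cutoff (g t))"
  unfolding cutoff_def by (intro continuous_intros)

text \<open>At most \<open>6\<close> integers lie within distance less than \<open>3\<close> of
  \<open>u\<close>, and each contributes at most \<open>9\<close>.\<close>

lemma sum_cutoff_sq_le:
  assumes u: "0 \<le> u"
  shows "(\<Sum>k\<le>n. (cutoff (u - real k))\<^sup>2) \<le> 54"
proof -
  define p where "p = nat \<lfloor>u\<rfloor>"
  have p: "real p \<le> u" "u < real p + 1" using u by (auto simp: p_def of_nat_floor)
  define S where "S = {k. k \<le> n \<and> \<bar>u - real k\<bar> < 3}"
  have sq: "(cutoff v)\<^sup>2 \<le> 9" if "\<bar>v\<bar> < 3" for v
  proof -
    have "\<bar>cutoff v\<bar> \<le> \<bar>v\<bar> * 1"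
      unfolding cutoff_def abs_mult by (intro mult_left_mono) auto
    then have "\<bar>cutoff v\<bar> \<le> \<bar>3\<bar>" using that by simp
    then have "(cutoff v)\<^sup>2 \<le> 3\<^sup>2" by (simp only: abs_le_square_iff)
    then show ?thesis by simp
  qed
  have "S \<subseteq> {p - 2..p + 3}"
  proof
    fix k assume "k \<in> S"
    then have "real p < real k + 3" "real k < real p + 4" using p by (auto simp: S_def)
    then have "p < k + 3" "k < p + 4" by linarith+
    then show "k \<in> {p - 2..p + 3}" by auto
  qed
  then have "card S \<le> card {p - 2..p + 3}" by (intro card_mono) auto
  also have "\<dots> \<le> 6" by simp
  finally have card: "card S \<le> 6" .
  have "(\<Sum>k\<le>n. (cutoff (u - real k))\<^sup>2) = (\<Sum>k\<in>S. (cutoff (u - real k))\<^sup>2)"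
    by (rule sum.mono_neutral_right) (auto simp: S_def cutoff_def)
  also have "\<dots> \<le> (\<Sum>k\<in>S. 9)" by (intro sum_mono sq) (auto simp: S_def)
  also have "\<dots> \<le> 54" using card by simp
  finally show ?thesis .
qed

section \<open>Consequences of equality for an operator and its compression\<close>

locale jensen_equality =
  H: sa_operator_interval "UNIV :: 'a::chilbert_space set" H lo hi
    + C: sa_operator_interval M "compression M H" lo hi
  for H M lo hi +
  fixes f :: "real \<Rightarrow> real"
  assumes lo_less_hi: "lo < hi"
    and f_convex: "strictly_convex_on {lo..hi} f" and f_cont: "continuous_on {lo..hi} f"
    and equality: "cfc M f (compression M H) = compression M (cfc UNIV f H)"
begin

text \<open>On \<open>M\<close> the forms agree for \<open>f\<close> by the equality hypothesis, for
  the operators themselves by the definition of compression, and for the identity;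
  \<open>fc_affine_shift\<close> combines the three.\<close>

lemma quadratic_form_eq:
  assumes x: "x \<in> M"
  shows "ri x (H.fc (\<lambda>s. f s - (c + d * s) + e) x) = ri x (C.fc (\<lambda>s. f s - (c + d * s) + e) x)"
proof -
  have "ri x (C.fc f x) = ri x (H.fc f x)"
    using x by (simp add: equality) (simp add: compression_def C.ri_orth_proj)
  moreover have "ri x (compression M H x) = ri x (H x)"
    using x by (simp add: compression_def C.ri_orth_proj)
  ultimately show ?thesis
    by (simp add: H.fc_affine_shift[OF f_cont] C.fc_affine_shift[OF f_cont x] ri_simps)
qed

text \<open>The range of \<open>\<phi>(C)\<close> is cut into cells by fine tents \<open>\<psi> i\<close>. On each cell \<open>w(H)\<^sup>2\<close> is
  dominated by a multiple of \<open>(f - \<ell>)(H) + e\<close>, whose quadratic form can be computed in \<open>C\<close>. The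
  cells are not orthogonal for \<open>H\<close>, but since \<open>\<Sum> e i\<close> is small, Cauchy-Schwarz suffices.\<close>

lemma separated_supports:
  assumes r: "0 < r"
    and \<phi>: "continuous_on {lo..hi} \<phi>" "\<And>s. s \<in> {lo..hi} \<Longrightarrow> r \<le> \<bar>s - m\<bar> \<Longrightarrow> \<phi> s = 0"
    and w: "continuous_on {lo..hi} w" "\<And>s. s \<in> {lo..hi} \<Longrightarrow> \<bar>s - m\<bar> \<le> 2 * r \<Longrightarrow> w s = 0"
    and x: "x \<in> M"
  shows "H.fc w (C.fc \<phi> x) = 0"
proof -
  define y where "y = C.fc \<phi> x"
  have y: "y \<in> M" unfolding y_def by (rule C.fc_mem[OF \<phi>(1) x])
  have "\<exists>B\<ge>0. \<forall>\<epsilon>>0. \<exists>n h c d e. 0 < n \<and> h = (hi - lo) / real n \<and> 0 < h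
      \<and> (\<forall>i\<le>n. 0 \<le> e i) \<and> (\<Sum>i\<le>n. e i) \<le> \<epsilon>
      \<and> (\<forall>i\<le>n. \<forall>s\<in>{lo..hi}. \<bar>s - (lo + real i * h)\<bar> \<le> h \<longrightarrow> f s - (c i + d i * s) \<le> e i)
      \<and> (\<forall>i\<le>n. \<forall>s\<in>{lo..hi}. \<bar>lo + real i * h - m\<bar> < r + h \<longrightarrow>
            (w s)\<^sup>2 \<le> B * (f s - (c i + d i * s) + e i))"
    by (rule chord_family[OF lo_less_hi f_convex f_cont w(1) _ r]) (rule w(2))
  then obtain B where B: "0 \<le> B" and family: "\<forall>\<epsilon>>0. \<exists>n h c d e. 0 < n \<and> h = (hi - lo) / real n \<and> 0 < h
      \<and> (\<forall>i\<le>n. 0 \<le> e i) \<and> (\<Sum>i\<le>n. e i) \<le> \<epsilon>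
      \<and> (\<forall>i\<le>n. \<forall>s\<in>{lo..hi}. \<bar>s - (lo + real i * h)\<bar> \<le> h \<longrightarrow> f s - (c i + d i * s) \<le> e i)
      \<and> (\<forall>i\<le>n. \<forall>s\<in>{lo..hi}. \<bar>lo + real i * h - m\<bar> < r + h \<longrightarrow>
            (w s)\<^sup>2 \<le> B * (f s - (c i + d i * s) + e i))"
    by (elim exE conjE)
  have "(norm (H.fc w y))\<^sup>2 \<le> 2 * B * (norm y)\<^sup>2 * \<epsilon>" if eps: "0 < \<epsilon>" for \<epsilon>
  proof -
    obtain n :: nat and h c d e where n: "0 < n" "h = (hi - lo) / real n" "0 < h"
      and e: "\<And>i. i \<le> n \<Longrightarrow> 0 \<le> e i" "(\<Sum>i\<le>n. e i) \<le> \<epsilon>"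
      and near: "\<And>i s. i \<le> n \<Longrightarrow> s \<in> {lo..hi} \<Longrightarrow> \<bar>s - (lo + real i * h)\<bar> \<le> h
        \<Longrightarrow> f s - (c i + d i * s) \<le> e i"
      and dom: "\<And>i s. i \<le> n \<Longrightarrow> s \<in> {lo..hi} \<Longrightarrow> \<bar>lo + real i * h - m\<bar> < r + h
        \<Longrightarrow> (w s)\<^sup>2 \<le> B * (f s - (c i + d i * s) + e i)"
      using family[rule_format, OF eps] by (elim exE conjE) (rule that; blast)
    have nh: "real n * h = hi - lo" using n(1,2) by simp
    define \<psi> where "\<psi> i s = tent ((s - lo) / h - real i)" for i s
    have \<psi>: "continuous_on {lo..hi} (\<psi> i)" for i
      unfolding \<psi>_def using n(3) by (intro continuous_tent continuous_intros) auto
    have \<psi>0: "\<psi> i s = 0" if "h \<le> \<bar>s - (lo + real i * h)\<bar>" for i s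
    proof -
      have "(s - lo) / h - real i = (s - (lo + real i * h)) / h" using n(3) by (simp add: field_simps)
      then show ?thesis using that n(3) by (simp add: \<psi>_def tent_eq_0)
    qed
    have u: "0 \<le> (s - lo) / h" "(s - lo) / h \<le> real n" if "s \<in> {lo..hi}" for s
      using that n(3) nh by (auto simp: pos_divide_le_eq)
    define z where "z i = C.fc (\<psi> i) y" for i
    have z: "z i \<in> M" for i unfolding z_def by (rule C.fc_mem[OF \<psi> y])
    have "y = C.fc (\<lambda>_. 1) y" by (simp add: C.fc_const[OF y])
    also have "\<dots> = C.fc (\<lambda>s. \<Sum>i\<le>n. \<psi> i s) y"
      by (rule C.fc_cong[OF continuous_on_const _ y]) (simp add: \<psi>_def sum_tent[OF u])
    also have "\<dots> = (\<Sum>i\<le>n. z i)" unfolding z_def by (rule C.fc_sum[OF \<psi> y])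
    finally have y_sum: "y = (\<Sum>i\<le>n. z i)" .
    have z_sum: "(\<Sum>i\<le>n. (norm (z i))\<^sup>2) \<le> 1 * (norm y)\<^sup>2"
      unfolding z_def by (rule C.sum_norm_fc_sq_le[OF \<psi> _ y]) (simp add: \<psi>_def sum_tent_sq_le[OF u])
    have cell: "(norm (H.fc w (z i)))\<^sup>2 \<le> 2 * B * e i * (norm (z i))\<^sup>2" if i: "i \<le> n" for i
    proof (cases "\<bar>lo + real i * h - m\<bar> < r + h")
      case True
      define k where "k s = f s - (c i + d i * s) + e i" for s
      have k: "continuous_on {lo..hi} k" unfolding k_def by (intro continuous_intros f_cont)
      have "(norm (H.fc w (z i)))\<^sup>2 = ri (z i) (H.fc (\<lambda>s. (w s)\<^sup>2) (z i))"
        by (rule H.norm_fc_sq[OF w(1) UNIV_I])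
      also have "\<dots> \<le> ri (z i) (H.fc (\<lambda>s. B * k s) (z i))"
        using dom[OF i _ True] by (intro H.fc_mono continuous_intros w k UNIV_I) (simp add: k_def)
      finally have le: "(norm (H.fc w (z i)))\<^sup>2 \<le> B * ri (z i) (H.fc k (z i))"
        by (simp add: H.fc_scale[OF k] ri_simps)
      have "ri (z i) (H.fc k (z i)) = ri (z i) (C.fc k (z i))"
        unfolding k_def by (rule quadratic_form_eq[OF z])
      also have "\<dots> = ri y (C.fc (\<psi> i) (C.fc k (z i)))"
        unfolding z_def by (rule C.fc_ri[OF \<psi> y C.fc_mem[OF k C.fc_mem[OF \<psi> y]]])
      also have "\<dots> = ri y (C.fc (\<lambda>s. \<psi> i s * (k s * \<psi> i s)) y)"
        by (simp add: z_def C.fc_mult[OF \<psi> continuous_on_mult[OF k \<psi>] y] C.fc_mult[OF k \<psi> y])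
      \<comment> \<open>On the support of \<open>\<psi> i\<close>, \<open>f\<close> minus the chord
        is at most \<open>e i\<close>; the shift in \<open>k\<close> adds another
        \<open>e i\<close>.\<close>
      also have "\<dots> \<le> ri y (C.fc (\<lambda>s. 2 * e i * (\<psi> i s)\<^sup>2) y)"
      proof (rule C.fc_mono[OF _ _ _ y])
        fix s assume s: "s \<in> {lo..hi}"
        show "\<psi> i s * (k s * \<psi> i s) \<le> 2 * e i * (\<psi> i s)\<^sup>2"
        proof (cases "\<bar>s - (lo + real i * h)\<bar> \<le> h")
          case True
          then have "k s * (\<psi> i s)\<^sup>2 \<le> 2 * e i * (\<psi> i s)\<^sup>2"
            using near[OF i s] by (intro mult_right_mono) (auto simp: k_def)
          then show ?thesis by (simp add: power2_eq_square mult_ac)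
        qed (simp add: \<psi>0)
      qed (intro continuous_intros \<psi> k)+
      also have "\<dots> = 2 * e i * (norm (z i))\<^sup>2"
        by (simp add: C.fc_scale[OF continuous_on_power[OF \<psi>] y] ri_simps z_def C.norm_fc_sq[OF \<psi> y])
      finally have "B * ri (z i) (H.fc k (z i)) \<le> B * (2 * e i * (norm (z i))\<^sup>2)"
        by (rule mult_left_mono[OF _ B])
      with le show ?thesis by (simp add: mult_ac)
    next
      case False
      \<comment> \<open>The node is at least \<open>r + h\<close> away from \<open>m\<close>, so
        \<open>\<psi> i\<close> and \<open>\<phi>\<close> have zero product and the cell contributes
        nothing.\<close>
      have "z i = C.fc (\<lambda>s. \<psi> i s * \<phi> s) x"
        unfolding z_def y_def by (rule C.fc_mult[OF \<psi> \<phi>(1) x, symmetric])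
      also have "\<dots> = C.fc (\<lambda>_. 0) x"
      proof (rule C.fc_cong[OF continuous_on_mult[OF \<psi> \<phi>(1)] _ x])
        fix s assume s: "s \<in> {lo..hi}"
        show "\<psi> i s * \<phi> s = 0"
        proof (cases "h \<le> \<bar>s - (lo + real i * h)\<bar>")
          case far: False
          then have "r \<le> \<bar>s - m\<bar>" using False by linarith
          then show ?thesis using \<phi>(2)[OF s] by simp
        qed (simp add: \<psi>0)
      qed
      also have "\<dots> = 0" by (simp add: C.fc_const x)
      finally show ?thesis using H.bounded_ops_zero[OF H.fc_bounded[OF w(1)]] by simp
    qed
    have "H.fc w y = (\<Sum>i\<le>n. H.fc w (z i))"
      unfolding y_sum by (rule H.bounded_ops_sum[OF H.fc_bounded[OF w(1)] UNIV_I])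
    then have "norm (H.fc w y) \<le> (\<Sum>i\<le>n. norm (H.fc w (z i)))" by (simp add: norm_sum)
    also have "\<dots> \<le> (\<Sum>i\<le>n. sqrt (2 * B * e i) * norm (z i))"
    proof (rule sum_mono)
      fix i assume "i \<in> {..n}"
      then have "norm (H.fc w (z i)) \<le> sqrt (2 * B * e i * (norm (z i))\<^sup>2)"
        using cell by (intro real_le_rsqrt) simp
      then show "norm (H.fc w (z i)) \<le> sqrt (2 * B * e i) * norm (z i)"
        by (simp add: real_sqrt_mult)
    qed
    finally have "(norm (H.fc w y))\<^sup>2 \<le> (\<Sum>i\<le>n. sqrt (2 * B * e i) * norm (z i))\<^sup>2"
      by (intro power_mono) auto
    \<comment> \<open>One factor is controlled by \<open>\<Sum> e i \<le> \<epsilon>\<close>, the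
      other by \<open>\<parallel>y\<parallel>\<^sup>2\<close>, whatever the number of cells.\<close>
    also have "\<dots> \<le> (\<Sum>i\<le>n. (sqrt (2 * B * e i))\<^sup>2) * (\<Sum>i\<le>n. (norm (z i))\<^sup>2)"
      by (rule Cauchy_Schwarz_ineq_sum)
    also have "(\<Sum>i\<le>n. (sqrt (2 * B * e i))\<^sup>2) = (\<Sum>i\<le>n. 2 * B * e i)"
      using B e(1) by (intro sum.cong) auto
    also have "\<dots> = 2 * B * (\<Sum>i\<le>n. e i)" by (simp add: sum_distrib_left)
    also have "2 * B * (\<Sum>i\<le>n. e i) * (\<Sum>i\<le>n. (norm (z i))\<^sup>2) \<le> 2 * B * \<epsilon> * (norm y)\<^sup>2"
      using B e z_sum eps by (intro mult_mono mult_left_mono sum_nonneg) auto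
    finally show ?thesis by (simp add: mult_ac)
  qed
  then have "(norm (H.fc w y))\<^sup>2 \<le> 0"
    by (rule nonpos_if_le_all_multiples) (use B in simp_all)
  then show ?thesis by (simp add: y_def)
qed

text \<open>The \<open>g k(H)\<close> are moved to the other side of the inner product, where the bounded overlap of
  the \<open>g k\<close> controls the sum of squares.\<close>

lemma norm_diff_compression_le:
  assumes x: "x \<in> M" and n: "0 < n"
  defines "z \<equiv> H x - compression M H x"
  shows "(norm z)\<^sup>2 \<le> 8 * ((hi - lo) / real n) * norm z * norm x"
proof -
  define r where "r = (hi - lo) / real n"
  have r: "0 < r" using n lo_less_hi by (simp add: r_def)
  have nr: "real n * r = hi - lo" using n by (simp add: r_def)
  have u: "0 \<le> (s - lo) / r" "(s - lo) / r \<le> real n" if "s \<in> {lo..hi}" for s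
    using that r nr by (auto simp: pos_divide_le_eq)
  define t where "t k = lo + real k * r" for k
  have ut: "(s - lo) / r - real k = (s - t k) / r" for s k
    using r by (simp add: t_def field_simps)
  define \<phi> g where "\<phi> k s = tent ((s - lo) / r - real k)"
    and "g k s = r * cutoff ((s - lo) / r - real k)" for k s
  have \<phi>: "continuous_on {lo..hi} (\<phi> k)" for k
    unfolding \<phi>_def using r by (intro continuous_tent continuous_intros) auto
  have g: "continuous_on {lo..hi} (g k)" for k
    unfolding g_def using r by (intro continuous_intros continuous_cutoff) auto
  define y where "y k = C.fc (\<phi> k) x" for k
  have "x = C.fc (\<lambda>_. 1) x" by (simp add: C.fc_const[OF x])
  also have "\<dots> = C.fc (\<lambda>s. \<Sum>k\<le>n. \<phi> k s) x"
    by (rule C.fc_cong[OF continuous_on_const _ x]) (simp add: \<phi>_def sum_tent[OF u])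
  also have "\<dots> = (\<Sum>k\<le>n. y k)" unfolding y_def by (rule C.fc_sum[OF \<phi> x])
  finally have x_sum: "x = (\<Sum>k\<le>n. y k)" .
  have "compression M H x = C.fc (\<lambda>s. s) x" by (simp add: C.fc_id[OF x])
  \<comment> \<open>Linear interpolation at the nodes reproduces the identity, so the decomposition
    of the compression is exact.\<close>
  also have "\<dots> = C.fc (\<lambda>s. \<Sum>k\<le>n. t k * \<phi> k s) x"
  proof (rule C.fc_cong[OF continuous_on_id _ x])
    fix s assume s: "s \<in> {lo..hi}"
    have "(\<Sum>k\<le>n. t k * \<phi> k s) = lo * (\<Sum>k\<le>n. \<phi> k s) + r * (\<Sum>k\<le>n. real k * \<phi> k s)"
      by (simp add: t_def sum_distrib_left algebra_simps sum.distrib)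
    also have "\<dots> = s"
      using r by (simp add: \<phi>_def sum_tent[OF u[OF s]] sum_mult_tent[OF u[OF s]])
    finally show "s = (\<Sum>k\<le>n. t k * \<phi> k s)" by simp
  qed
  also have "\<dots> = (\<Sum>k\<le>n. C.fc (\<lambda>s. t k * \<phi> k s) x)"
    by (rule C.fc_sum[OF continuous_on_mult_left[OF \<phi>] x])
  also have "\<dots> = (\<Sum>k\<le>n. t k *\<^sub>R y k)"
    by (simp add: C.fc_scale[OF \<phi> x] y_def)
  finally have C_sum: "compression M H x = (\<Sum>k\<le>n. t k *\<^sub>R y k)" .
  have local: "H (y k) - t k *\<^sub>R y k = H.fc (g k) (y k)" for k
  proof -
    \<comment> \<open>\<open>w\<close> vanishes within \<open>2 * r\<close> of \<open>t k\<close>,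
      where \<open>cutoff\<close> is still the identity, while \<open>\<phi> k\<close> vanishes
      beyond \<open>r\<close>. So \<open>separated_supports\<close> lets the localised
      \<open>g k\<close> replace \<open>s - t k\<close> on \<open>y k\<close>.\<close>
    define w where "w s = (s - t k) - g k s" for s
    have w: "continuous_on {lo..hi} w" unfolding w_def by (intro continuous_intros g)
    have "H.fc w (y k) = 0"
      unfolding y_def
    proof (rule separated_supports[OF r \<phi> _ w _ x])
      fix s
      show "\<phi> k s = 0" if "r \<le> \<bar>s - t k\<bar>"
        using that r by (simp add: \<phi>_def ut tent_eq_0)
      show "w s = 0" if "\<bar>s - t k\<bar> \<le> 2 * r"
      proof -
        have "\<bar>(s - t k) / r\<bar> \<le> 2" using that r by (simp add: pos_divide_le_eq)
        then show ?thesis using r by (simp add: w_def g_def ut cutoff_eq)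
      qed
    qed
    moreover have "H.fc w (y k) = (H.fc (\<lambda>s. s) (y k) - H.fc (\<lambda>_. t k) (y k)) - H.fc (g k) (y k)"
      unfolding w_def by (simp add: H.fc_diff g continuous_on_diff continuous_on_id continuous_on_const)
    ultimately show ?thesis by (simp add: H.fc_id H.fc_const)
  qed
  have "z = (\<Sum>k\<le>n. H (y k) - t k *\<^sub>R y k)"
    unfolding z_def C_sum sum_subtractf
    by (subst x_sum) (simp add: H.bounded_ops_sum[OF H.T_bounded])
  then have z: "z = (\<Sum>k\<le>n. H.fc (g k) (y k))" by (simp only: local)
  have "(norm z)\<^sup>2 = (\<Sum>k\<le>n. ri z (H.fc (g k) (y k)))"
    using arg_cong[OF z, of "ri z"] by (simp add: ri_same ri_sum_right)
  also have "\<dots> = (\<Sum>k\<le>n. ri (H.fc (g k) z) (y k))"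
    by (simp add: H.fc_ri[OF g])
  also have "\<dots> \<le> (\<Sum>k\<le>n. norm (H.fc (g k) z) * norm (y k))"
    by (intro sum_mono ri_le_norm)
  finally have "((norm z)\<^sup>2)\<^sup>2 \<le> (\<Sum>k\<le>n. norm (H.fc (g k) z) * norm (y k))\<^sup>2"
    by (intro power_mono) auto
  also have "\<dots> \<le> (\<Sum>k\<le>n. (norm (H.fc (g k) z))\<^sup>2) * (\<Sum>k\<le>n. (norm (y k))\<^sup>2)"
    by (rule Cauchy_Schwarz_ineq_sum)
  also have "\<dots> \<le> (54 * r\<^sup>2 * (norm z)\<^sup>2) * (1 * (norm x)\<^sup>2)"
  proof (intro mult_mono sum_nonneg)
    show "(\<Sum>k\<le>n. (norm (H.fc (g k) z))\<^sup>2) \<le> 54 * r\<^sup>2 * (norm z)\<^sup>2"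
    proof (rule H.sum_norm_fc_sq_le[OF g _ UNIV_I])
      fix s assume "s \<in> {lo..hi}"
      from mult_left_mono[OF sum_cutoff_sq_le[OF u(1)[OF this], of n], of "r\<^sup>2"]
      show "(\<Sum>k\<le>n. (g k s)\<^sup>2) \<le> 54 * r\<^sup>2"
        by (simp add: g_def power_mult_distrib sum_distrib_left)
    qed
    show "(\<Sum>k\<le>n. (norm (y k))\<^sup>2) \<le> 1 * (norm x)\<^sup>2"
      unfolding y_def by (rule C.sum_norm_fc_sq_le[OF \<phi> _ x]) (simp add: \<phi>_def sum_tent_sq_le[OF u])
  qed auto
  \<comment> \<open>Rounding \<open>54\<close> up to \<open>8\<^sup>2\<close> makes the bound a
    perfect square.\<close>
  also have "\<dots> \<le> 64 * (r\<^sup>2 * (norm z)\<^sup>2 * (norm x)\<^sup>2)"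
    by (simp add: mult_right_mono)
  also have "\<dots> = (8 * r * norm z * norm x)\<^sup>2"
    by (simp add: power_mult_distrib)
  finally have "(norm z)\<^sup>2 \<le> 8 * r * norm z * norm x"
    by (rule power2_le_imp_le) (use r in simp)
  then show ?thesis by (simp add: r_def)
qed

lemma compression_eq:
  assumes x: "x \<in> M"
  shows "H x = compression M H x"
proof -
  define z where "z = H x - compression M H x"
  have "(norm z)\<^sup>2 \<le> (8 * norm z * norm x) * \<epsilon>" if eps: "0 < \<epsilon>" for \<epsilon>
  proof -
    obtain n where n: "(hi - lo) / \<epsilon> < real n" using reals_Archimedean2 by blast
    moreover have "0 < (hi - lo) / \<epsilon>" using lo_less_hi eps by simp
    ultimately have n0: "0 < n" using less_trans of_nat_0_less_iff by blast
    have "(hi - lo) / real n \<le> \<epsilon>"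
      using n n0 eps by (simp add: field_simps)
    then have "8 * ((hi - lo) / real n) * norm z * norm x \<le> 8 * \<epsilon> * norm z * norm x"
      by (intro mult_right_mono mult_left_mono) simp_all
    then show ?thesis
      using norm_diff_compression_le[OF x n0] by (simp add: z_def mult_ac)
  qed
  then have "(norm z)\<^sup>2 \<le> 0" by (rule nonpos_if_le_all_multiples) simp_all
  then show ?thesis by (simp add: z_def)
qed

end

section \<open>Reduction to the convex hull of the spectrum\<close>

theorem corollary2p7:
  fixes H :: "'a::chilbert_space \<Rightarrow> 'a" and M :: "'a set"
    and f :: "real \<Rightarrow> real" and I :: "real set"
  assumes "H \<in> self_adjoint_ops UNIV"
    and "complex_vector.subspace M" and "closed M"
    and "is_interval I" and "op_spectrum UNIV H \<subseteq> complex_of_real ` I"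
    and "continuous_on I f" and "strictly_convex_on I f"
    and "cfc M f (compression M H) = compression M (cfc UNIV f H)"
  shows "H ` M \<subseteq> M"
proof (cases "(UNIV :: 'a set) = {0}")
  case True
  then have "H x = 0" for x by (metis UNIV_I singletonD)
  then show ?thesis using complex_vector.subspace_0[OF assms(2)] by (intro image_subsetI) simp
next
  case nontrivial: False
  interpret H: sa_operator UNIV H
    by unfold_locales (simp_all add: assms(1))
  interpret M: closed_csubspace M
    by unfold_locales (simp_all add: assms(2,3))
  interpret C: sa_operator M "compression M H"
    by unfold_locales (rule M.compression_self_adjoint[OF assms(1)])
  \<comment> \<open>The ends of the numerical range; the upper one is obtained as the lower one of
    \<open>- H\<close>.\<close>
  define lo hi where "lo = H.num_inf (H.opp [:0, 1:])" and "hi = - H.num_inf (H.opp [:0, - 1:])"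
  have lo: "lo * (norm x)\<^sup>2 \<le> ri x (H x)" for x
    using H.num_inf_le[OF H.opp_self_adjoint, of x "[:0, 1:]"] by (simp add: lo_def H.opp_linear)
  have hi: "ri x (H x) \<le> hi * (norm x)\<^sup>2" for x
    using H.num_inf_le[OF H.opp_self_adjoint, of x "[:0, - 1:]"]
    by (simp add: hi_def H.opp_linear ri_simps)
  have real_part: "t \<in> I" if "t \<in> H.rspec" for t
    using that assms(5) by auto
  have lo_mem: "lo \<in> H.rspec"
    using H.num_inf_root[OF nontrivial, of "[:0, 1:]"] by (auto simp: lo_def)
  obtain t where t: "t \<in> H.rspec" "poly [:0, - 1:] t = H.num_inf (H.opp [:0, - 1:])"
    using H.num_inf_root[OF nontrivial] by blast
  have th: "t = hi" unfolding hi_def t(2)[symmetric] by simp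
  \<comment> \<open>By \<open>num_inf_root\<close> both ends are spectral points, hence lie in
    \<open>I\<close>, and \<open>I\<close> is an interval.\<close>
  have sub: "{lo..hi} \<subseteq> I"
  proof
    fix s assume "s \<in> {lo..hi}"
    then show "s \<in> I"
      using mem_is_interval_1_I[OF assms(4) real_part[OF lo_mem] real_part[OF t(1)], of s] th by simp
  qed
  have specH: "H.rspec \<subseteq> {lo..hi}" by (rule H.rspec_bounds) (rule lo, rule hi)
  have form: "ri x (compression M H x) = ri x (H x)" if "x \<in> M" for x
    using that by (simp add: compression_def M.ri_orth_proj)
  \<comment> \<open>The compression has the same quadratic form on \<open>M\<close>, so its spectrum
    obeys the same bounds.\<close>
  have specC: "C.rspec \<subseteq> {lo..hi}"
    by (rule C.rspec_bounds) (simp_all add: form lo hi)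
  show ?thesis
  proof (cases "lo < hi")
    case True
    interpret jensen_equality H M lo hi f
    proof unfold_locales
      show "H.rspec \<subseteq> {lo..hi}" "C.rspec \<subseteq> {lo..hi}" by (fact specH, fact specC)
      show "strictly_convex_on {lo..hi} f" by (rule strictly_convex_on_subset[OF assms(7) sub])
      show "continuous_on {lo..hi} f" by (rule continuous_on_subset[OF assms(6) sub])
    qed (fact True, fact assms(8))
    show ?thesis using compression_eq C.T_mem by auto
  next
    case False
    \<comment> \<open>In the degenerate case the spectrum contains no point besides
      \<open>lo\<close>, so \<open>H\<close> is the scalar \<open>lo\<close> and preserves every
      subspace.\<close>
    have "norm (H.opp [:- lo, 1:] x) \<le> 0 * norm x" for x
    proof (rule H.norm_opp_le)
      fix t assume "t \<in> H.rspec"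
      then have "t \<in> {lo..hi}" using specH by blast
      then show "\<bar>poly [:- lo, 1:] t\<bar> \<le> 0" using False by simp
    qed auto
    then have "H x = lo *\<^sub>R x" for x by (simp add: H.opp_linear)
    then show ?thesis using M.scaleR_mem by auto
  qed
qed

end
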